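(* There exists a function $\nu^*(\cdot)$ with $\lim_{T\to\infty}\nu^*(T)=0$ such that $$\sup_{\chi\in B_T(y_0)}E[\rho(\chi,W)]\le\nu^*(T)$$ for every initial condition $y_0\in Y$ (and every positive integer $T$).
   Context: Setting. $Y\subset\mathbb R^m$ is compact, $\hat U$ and $S$ are compact metric spaces, $f:Y\times\hat U\times S\to\mathbb R^m$ is continuous, and $f(y,u,\sigma)\in Y$ for all $(y,u,\sigma)\in Y\times\hat U\times S$. $\sigma(0),\sigma(1),\dots$ are independent, identically distributed random elements of $S$ on a common probability space; $\sigma$ denotes a random element with their common law. The system is $y(t+1)=f(y(t),u(t),\sigma(t))$, $y(0)=y_0\in Y$, $t=0,1,2,\dots$. A control plan is a sequence $\pi=\{\pi_t\}_{t\ge0}$ with $\pi_0\in\hat U$ and $\pi_t:S^t\to\hat U$ Borel measurable for $t\ge1$; the controls are $u(0)=\pi_0$, $u(t)=\pi_t(\sigma(0),\dots,\sigma(t-1))$. $\Pi$ is the set of all control plans, and $(y^{\pi,y_0}(\cdot),u^{\pi,y_0}(\cdot))$ is the resulting state-control trajectory. Random occupational measures. $\mathcal P(Y\times\hat U)$ is the set of Borel probability measures on $Y\times\hat U$. For a positive integer $T$ and Borel $Q\subset Y\times\hat U$, $\chi^{\pi,y_0,T}(Q)=\frac1T\sum_{t=0}^{T-1}1_Q(y^{\pi,y_0}(t),u^{\pi,y_0}(t))$, and $B_T(y_0)=\bigcup_{\pi\in\Pi}\{\chi^{\pi,y_0,T}\}$. Stationary measures. $W=\big\{\gamma\in\mathcal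 P(Y\times\hat U):\int_{Y\times\hat U}\big(E[\varphi(f(y,u,\sigma))]-\varphi(y)\big)\gamma(dy,du)=0\ \ \forall\varphi\in C(Y)\big\}$. Metric. $q_1,q_2,\dots$ is a fixed sequence of Lipschitz continuous functions dense in the unit ball of $C(Y\times\hat U)$. $\rho(\gamma',\gamma'')=\sum_{j\ge1}2^{-j}\big|\int q_j\,d\gamma'-\int q_j\,d\gamma''\big|$ and $\rho(\gamma,W)=\inf_{\gamma'\in W}\rho(\gamma,\gamma')$. *)

theory Defs
  imports "HOL-Probability.Probability"
begin

text \<open>Compact spaces are rendered as compact subsets \<^term>\<open>X\<close> of a metric space type;
  the Borel \<open>\<sigma>\<close>-algebra of such a subspace is \<^term>\<open>restrict_space borel X\<close>.\<close>

definition borel_probs :: "'a::topological_space set \<Rightarrow> 'a measure set" where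
  "borel_probs X = {\<gamma>. prob_space \<gamma> \<and> sets \<gamma> = sets (restrict_space borel X)}"

text \<open>\<open>S\<^sup>t\<close> is the space of functions on \<open>{..<t}\<close> with the product \<open>\<sigma>\<close>-algebra, which is the Borel
  \<open>\<sigma>\<close>-algebra of the product because a compact metric space is second countable. For \<open>t = 0\<close> it is
  a one-point space, so that \<open>\<pi> 0\<close> is just an element of \<open>U\<close>.\<close>

definition control_plans ::
    "'u::metric_space set \<Rightarrow> 's::metric_space set \<Rightarrow> (nat \<Rightarrow> (nat \<Rightarrow> 's) \<Rightarrow> 'u) set" where
  "control_plans U S =
     {\<pi>. \<forall>t. \<pi> t \<in> measurable (PiM {..<t} (\<lambda>_. restrict_space borel S)) (restrict_space borel U)}"

definition control :: "(nat \<Rightarrow> (nat \<Rightarrow> 's) \<Rightarrow> 'u) \<Rightarrow> (nat \<Rightarrow> 's) \<Rightarrow> nat \<Rightarrow> 'u" where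
  "control \<pi> s t = \<pi> t (restrict s {..<t})"

primrec state ::
    "('y \<times> 'u \<times> 's \<Rightarrow> 'y) \<Rightarrow> (nat \<Rightarrow> (nat \<Rightarrow> 's) \<Rightarrow> 'u) \<Rightarrow> 'y \<Rightarrow> (nat \<Rightarrow> 's) \<Rightarrow> nat \<Rightarrow> 'y" where
  "state f \<pi> y0 s 0 = y0"
| "state f \<pi> y0 s (Suc t) = f (state f \<pi> y0 s t, control \<pi> s t, s t)"

definition occ_measure :: "'a::topological_space set \<Rightarrow> nat \<Rightarrow> (nat \<Rightarrow> 'a) \<Rightarrow> 'a measure" where
  "occ_measure X T z =
     measure_of X (sets (restrict_space borel X))
       (\<lambda>Q. ennreal (1 / real T * (\<Sum>t<T. indicator Q (z t))))"

text \<open>Since \<^const>\<open>measure_of\<close> yields the null measure when applied to a set function that is not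
  \<open>\<sigma>\<close>-additive, we record that it has the intended values here.\<close>

lemma sets_occ_measure: "sets (occ_measure X T z) = sets (restrict_space borel X)"
  unfolding occ_measure_def
  by (metis sets.sigma_sets_eq sets.space_closed sets_measure_of space_restrict_space2
      space_restrict_space space_borel Int_UNIV_right)

lemma emeasure_occ_measure:
  assumes Q: "Q \<in> sets (restrict_space borel X)"
  shows "emeasure (occ_measure X T z) Q = ennreal (1 / real T * (\<Sum>t<T. indicator Q (z t)))"
proof -
  let ?B = "restrict_space borel X"
  let ?m = "\<lambda>Q. ennreal (1 / real T * (\<Sum>t<T. indicator Q (z t)))"
  have sp: "space ?B = X" by (simp add: space_restrict_space)
  have m: "?m Q = (\<Sum>t<T. ennreal (1 / real T) * indicator Q (z t))" for Q
  proof -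
    have "?m Q = ennreal (\<Sum>t<T. 1 / real T * indicator Q (z t))"
      by (simp only: sum_distrib_left)
    also have "\<dots> = (\<Sum>t<T. ennreal (1 / real T * indicator Q (z t)))"
      by (rule sum_ennreal[symmetric]) simp
    also have "\<dots> = (\<Sum>t<T. ennreal (1 / real T) * indicator Q (z t))"
      by (rule sum.cong) (auto simp: indicator_def)
    finally show ?thesis .
  qed
  have "countably_additive (sets ?B) ?m"
    unfolding countably_additive_def
  proof (intro allI impI)
    fix A :: "nat \<Rightarrow> 'a set"
    assume "disjoint_family A"
    then show "(\<Sum>i. ?m (A i)) = ?m (\<Union> (range A))"
      by (simp only: m, subst suminf_sum) (auto simp: suminf_indicator)
  qed
  moreover have "positive (sets ?B) ?m" by (simp add: positive_def)
  ultimately have "emeasure (measure_of (space ?B) (sets ?B) ?m) Q = ?m Q"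
    using Q by (intro emeasure_measure_of_sigma) (auto intro: sets.sigma_algebra_axioms)
  then show ?thesis by (simp add: occ_measure_def sp)
qed

text \<open>A random measure is a map from the sample space; \<open>\<chi>\<close> is driven by the noise \<open>\<sigma> 0, \<sigma> 1, \<dots>\<close>.\<close>

definition random_occ_measure ::
    "'y::topological_space set \<Rightarrow> 'u::topological_space set \<Rightarrow> ('y \<times> 'u \<times> 's \<Rightarrow> 'y) \<Rightarrow> (nat \<Rightarrow> 'w \<Rightarrow> 's)
     \<Rightarrow> (nat \<Rightarrow> (nat \<Rightarrow> 's) \<Rightarrow> 'u) \<Rightarrow> 'y \<Rightarrow> nat \<Rightarrow> 'w \<Rightarrow> ('y \<times> 'u) measure" where
  "random_occ_measure Y U f \<sigma> \<pi> y0 T \<omega> =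
     occ_measure (Y \<times> U) T (\<lambda>t. (state f \<pi> y0 (\<lambda>i. \<sigma> i \<omega>) t, control \<pi> (\<lambda>i. \<sigma> i \<omega>) t))"

definition random_occ_measures ::
    "'y::metric_space set \<Rightarrow> 'u::metric_space set \<Rightarrow> 's::metric_space set \<Rightarrow> ('y \<times> 'u \<times> 's \<Rightarrow> 'y)
     \<Rightarrow> (nat \<Rightarrow> 'w \<Rightarrow> 's) \<Rightarrow> nat \<Rightarrow> 'y \<Rightarrow> ('w \<Rightarrow> ('y \<times> 'u) measure) set" where
  "random_occ_measures Y U S f \<sigma> T y0 =
     (\<Union>\<pi>\<in>control_plans U S. {random_occ_measure Y U f \<sigma> \<pi> y0 T})"

text \<open>Here \<open>\<mu>\<close> is the law of the noise.\<close>

definition stationary_measures ::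
    "'y::metric_space set \<Rightarrow> 'u::metric_space set \<Rightarrow> ('y \<times> 'u \<times> 's \<Rightarrow> 'y) \<Rightarrow> 's measure
     \<Rightarrow> ('y \<times> 'u) measure set" where
  "stationary_measures Y U f \<mu> =
     {\<gamma> \<in> borel_probs (Y \<times> U).
        \<forall>\<phi> :: 'y \<Rightarrow> real. continuous_on Y \<phi> \<longrightarrow>
          (\<integral>(y, u). ((\<integral>s. \<phi> (f (y, u, s)) \<partial>\<mu>) - \<phi> y) \<partial>\<gamma>) = 0}"

text \<open>The sequence is indexed from 1, so \<open>q 0\<close> is irrelevant.\<close>

definition dense_lipschitz_seq :: "'a::metric_space set \<Rightarrow> (nat \<Rightarrow> 'a \<Rightarrow> real) \<Rightarrow> bool" where
  "dense_lipschitz_seq X q \<longleftrightarrow>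
     (\<forall>j\<ge>1. (\<exists>L. L-lipschitz_on X (q j)) \<and> (\<forall>x\<in>X. \<bar>q j x\<bar> \<le> 1)) \<and>
     (\<forall>g. continuous_on X g \<and> (\<forall>x\<in>X. \<bar>g x\<bar> \<le> 1) \<longrightarrow>
        (\<forall>\<epsilon>>0. \<exists>j\<ge>1. \<forall>x\<in>X. \<bar>q j x - g x\<bar> < \<epsilon>))"

definition rho :: "(nat \<Rightarrow> 'a \<Rightarrow> real) \<Rightarrow> 'a measure \<Rightarrow> 'a measure \<Rightarrow> real" where
  "rho q \<gamma>' \<gamma>'' =
     (\<Sum>j. (1 / 2) ^ Suc j * \<bar>(\<integral>x. q (Suc j) x \<partial>\<gamma>') - (\<integral>x. q (Suc j) x \<partial>\<gamma>'')\<bar>)"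

definition rho_set :: "(nat \<Rightarrow> 'a \<Rightarrow> real) \<Rightarrow> 'a measure \<Rightarrow> 'a measure set \<Rightarrow> real" where
  "rho_set q \<gamma> W = (INF \<gamma>'\<in>W. rho q \<gamma> \<gamma>')"

end

theory Submission
  imports Defs
begin

text \<open>
  For \<open>\<phi> \<in> C(Y)\<close> put \<open>L\<phi> (y, u) = E[\<phi> (f (y, u, \<sigma>))] - \<phi> y\<close>, so that \<open>W\<close> is the set of probability
  measures annihilating every \<open>L\<phi>\<close>. Along a trajectory, \<open>L\<phi> (y t, u t)\<close> equals the martingale
  difference \<open>E[\<phi> (y (t+1)) | \<sigma> 0, \<dots>, \<sigma> (t-1)] - \<phi> (y (t+1))\<close> up to a telescoping term; martingale
  differences are orthogonal in \<open>L\<^sup>2\<close>, whence \<open>E \<bar>\<integral> L\<phi> d\<chi>\<bar> \<le> 4 / sqrt T\<close> for \<open>\<bar>\<phi>\<bar> \<le> 1\<close>, uniformly in the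
  initial state and the plan. By compactness of the space of probability measures, \<open>\<rho>(\<gamma>, W) < \<epsilon>\<close> as
  soon as finitely many of the numbers \<open>\<integral> L\<phi> d\<gamma>\<close> are small, and \<open>\<rho> \<le> 2\<close> always; so \<open>\<rho>(\<chi>, W)\<close> is
  dominated by \<open>\<epsilon>\<close> plus a multiple of a finite sum of terms \<open>\<bar>\<integral> L\<phi> d\<chi>\<bar>\<close>. This domination also
  makes measurability of \<open>\<rho>(\<chi>, W)\<close> irrelevant: the Bochner integral of a non-integrable
  function is \<open>0\<close>.
\<close>

subsection \<open>Compact metric spaces\<close>

text \<open>The balls of radius \<open>1 / Suc n\<close> around finite nets, over all
  \<open>n\<close>, form one sequence. Each level is finite, hence a single bound \<open>N\<close>
  on the indices serves all points of \<open>K\<close>; this uniformity later makes the inverse of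
  the code uniformly continuous.\<close>

lemma compact_small_open_sequence:
  fixes K :: "'a::metric_space set"
  assumes "compact K"
  shows "\<exists>B :: nat \<Rightarrow> 'a set. (\<forall>i. open (B i)) \<and>
    (\<forall>\<epsilon>>0. \<exists>N. \<forall>x\<in>K. \<exists>i<N. x \<in> B i \<and> (\<forall>y\<in>B i. \<forall>z\<in>B i. dist y z < \<epsilon>))"
proof -
  have "\<exists>F. finite F \<and> K \<subseteq> (\<Union>x\<in>F. ball x (1 / real (Suc n)))" for n
    using assms unfolding compact_eq_totally_bounded by (metis of_nat_0_less_iff zero_less_Suc zero_less_divide_1_iff) 
  then obtain F where F: "\<And>n. finite (F n)" "\<And>n. K \<subseteq> (\<Union>x\<in>F n. ball x (1 / real (Suc n)))"
    by metis
  define \<B> where "\<B> n = (\<lambda>x. ball x (1 / real (Suc n))) ` F n" for n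
  \<comment> \<open>The empty set keeps \<open>C\<close> nonempty even when \<open>K\<close> is
    empty, as the enumeration by \<open>from_nat_into\<close> requires.\<close>
  define C where "C = insert {} (\<Union>n. \<B> n)"
  have C: "countable C" "C \<noteq> {}"
    by (auto simp: C_def \<B>_def F(1) countable_finite)
  define B where "B = from_nat_into C"
  have rB: "range B = C"
    unfolding B_def using C by (simp add: range_from_nat_into)
  show ?thesis
  proof (intro exI[of _ B] conjI allI impI)
    fix i
    have "B i \<in> C" using rB by auto
    then show "open (B i)" by (auto simp: C_def \<B>_def)
  next
    fix \<epsilon> :: real assume "\<epsilon> > 0"
    then obtain n where n: "1 / real (Suc n) < \<epsilon> / 2"
      using nat_approx_posE[of "\<epsilon>/2"] by auto
    have "\<exists>i. B i = b" if "b \<in> \<B> n" for b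
      using that rB by (metis C_def UN_I UNIV_I image_iff insertCI)
    then obtain k where k: "\<And>b. b \<in> \<B> n \<Longrightarrow> B (k b) = b" by metis
    have "finite (k ` \<B> n)" by (simp add: \<B>_def F(1))
    from finite_nat_bounded[OF this] obtain N where N: "k ` \<B> n \<subseteq> {..<N}" ..
    show "\<exists>N. \<forall>x\<in>K. \<exists>i<N. x \<in> B i \<and> (\<forall>y\<in>B i. \<forall>z\<in>B i. dist y z < \<epsilon>)"
    proof (rule exI[of _ N], rule ballI)
      fix x assume "x \<in> K"
      then obtain a where a: "a \<in> F n" "x \<in> ball a (1 / real (Suc n))" using F(2)[of n] by auto
      let ?b = "ball a (1 / real (Suc n))"
      have b: "?b \<in> \<B> n" using a by (auto simp: \<B>_def)
      have "dist y z < \<epsilon>" if "y \<in> ?b" "z \<in> ?b" for y z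
        using that n dist_triangle3[of y z a] by (auto simp: dist_commute)
      then show "\<exists>i<N. x \<in> B i \<and> (\<forall>y\<in>B i. \<forall>z\<in>B i. dist y z < \<epsilon>)"
        using a(2) subsetD[OF N imageI[OF b]] k[OF b] by (intro exI[of _ "k ?b"]) simp
    qed
  qed
qed

text \<open>The ambient types need not be second countable, so the Borel \<open>\<sigma>\<close>-algebra of a product may be
  strictly finer than the product \<open>\<sigma>\<close>-algebra; on compact subsets the two agree.\<close>

lemma measurable_Pair_compact:
  fixes A :: "'a::metric_space set" and B :: "'b::metric_space set"
  assumes "compact A" "compact B"
    and g: "g \<in> measurable N (restrict_space borel A)"
    and h: "h \<in> measurable N (restrict_space borel B)"
  shows "(\<lambda>x. (g x, h x)) \<in> measurable N (restrict_space borel (A \<times> B))"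
proof (rule measurable_restrict_space2)
  have gA: "g x \<in> A" and hB: "h x \<in> B" if "x \<in> space N" for x
    using measurable_space[OF g that] measurable_space[OF h that] by (auto simp: space_restrict_space)
  then show "(\<lambda>x. (g x, h x)) \<in> space N \<rightarrow> A \<times> B" by auto
  have g': "g \<in> measurable N borel" and h': "h \<in> measurable N borel"
    using g h by (auto simp: measurable_restrict_space2_iff)
  obtain P :: "nat \<Rightarrow> 'a set" where P: "\<And>i. open (P i)"
    and P': "\<And>\<epsilon>. \<epsilon> > 0 \<Longrightarrow> \<exists>N. \<forall>x\<in>A. \<exists>i<N. x \<in> P i \<and> (\<forall>y\<in>P i. \<forall>z\<in>P i. dist y z < \<epsilon>)"
    using compact_small_open_sequence[OF \<open>compact A\<close>] by blast
  obtain R :: "nat \<Rightarrow> 'b set" where R: "\<And>i. open (R i)"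
    and R': "\<And>\<epsilon>. \<epsilon> > 0 \<Longrightarrow> \<exists>N. \<forall>x\<in>B. \<exists>i<N. x \<in> R i \<and> (\<forall>y\<in>R i. \<forall>z\<in>R i. dist y z < \<epsilon>)"
    using compact_small_open_sequence[OF \<open>compact B\<close>] by blast
  show "(\<lambda>x. (g x, h x)) \<in> borel_measurable N"
  proof (rule borel_measurableI)
    fix O' :: "('a \<times> 'b) set" assume "open O'"
    \<comment> \<open>\<open>I\<close> consists of pairs of naturals, so the preimage of an open set
      becomes a countable union of measurable rectangles.\<close>
    define I where "I = {(i, j). P i \<times> R j \<subseteq> O'}"
    have "(\<lambda>x. (g x, h x)) -` O' \<inter> space N =
       (\<Union>(i, j)\<in>I. (g -` P i \<inter> space N) \<inter> (h -` R j \<inter> space N))" (is "?L = ?R")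
    proof
      show "?R \<subseteq> ?L" by (auto simp: I_def)
      show "?L \<subseteq> ?R"
      proof
        fix x assume x: "x \<in> ?L"
        then obtain a b where ab: "open a" "open b" "g x \<in> a" "h x \<in> b" "a \<times> b \<subseteq> O'"
          using \<open>open O'\<close> by (auto simp: open_prod_def)
        obtain e1 e2 where e: "e1 > 0" "ball (g x) e1 \<subseteq> a" "e2 > 0" "ball (h x) e2 \<subseteq> b"
          using ab by (meson open_contains_ball)
        obtain i where i: "g x \<in> P i" "\<forall>y\<in>P i. \<forall>z\<in>P i. dist y z < e1"
          using P'[OF e(1)] gA x by fastforce
        obtain j where j: "h x \<in> R j" "\<forall>y\<in>R j. \<forall>z\<in>R j. dist y z < e2"
          using R'[OF e(3)] hB x by fastforce
        have "P i \<subseteq> ball (g x) e1" "R j \<subseteq> ball (h x) e2" using i j by auto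
        then have "P i \<times> R j \<subseteq> a \<times> b" using e by blast
        then have "(i, j) \<in> I" using ab(5) by (auto simp: I_def)
        then show "x \<in> ?R" using x i j by auto
      qed
    qed
    also have "\<dots> \<in> sets N"
      using P R g' h' by (intro sets.countable_UN'') (auto intro!: sets.Int measurable_sets borel_open)
    finally show "(\<lambda>x. (g x, h x)) -` O' \<inter> space N \<in> sets N" .
  qed
qed

text \<open>Codes \<open>K\<close> into \<open>[0, 1]\<close> by a ternary expansion, so that Helly's selection theorem for measures on
  the line applies to measures on \<open>K\<close>. The code is not continuous, but its inverse is uniformly so.\<close>

lemma compact_Borel_code:
  fixes K :: "'a::metric_space set"
  assumes "compact K"
  shows "\<exists>c :: 'a \<Rightarrow> real. c \<in> borel_measurable borel \<and> (\<forall>x. 0 \<le> c x \<and> c x \<le> 1) \<and>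
    (\<forall>\<epsilon>>0. \<exists>\<delta>>0. \<forall>x\<in>K. \<forall>y\<in>K. \<bar>c x - c y\<bar> < \<delta> \<longrightarrow> dist x y < \<epsilon>)"
proof -
  obtain B :: "nat \<Rightarrow> 'a set" where B: "\<And>i. open (B i)"
    and B': "\<And>\<epsilon>. \<epsilon> > 0 \<Longrightarrow> \<exists>N. \<forall>x\<in>K. \<exists>i<N. x \<in> B i \<and> (\<forall>y\<in>B i. \<forall>z\<in>B i. dist y z < \<epsilon>)"
    using compact_small_open_sequence[OF \<open>compact K\<close>] by blast
  define c :: "'a \<Rightarrow> real" where "c x = (\<Sum>i. indicator (B i) x * (1/3) ^ Suc i)" for x
  have geo: "(\<lambda>i. (1/3) ^ Suc (i + n)) sums ((1/3) ^ n / 2 :: real)" for n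
    using sums_mult[OF geometric_sums[of "1/3::real"], of "(1/3) ^ Suc n"]
    by (simp add: power_add mult_ac)
  have summ: "summable (\<lambda>i. indicator (B i) x * (1/3) ^ Suc i :: real)" for x
    by (rule summable_comparison_test[OF _ sums_summable[OF geo[of 0]]])
       (auto intro!: exI[of _ 0] simp: indicator_def)
  have c01: "0 \<le> c x \<and> c x \<le> 1" for x
  proof
    show "0 \<le> c x" unfolding c_def by (rule suminf_nonneg[OF summ]) auto
    have "c x \<le> (\<Sum>i. (1/3) ^ Suc (i + 0))"
      unfolding c_def by (rule suminf_le[OF _ summ sums_summable[OF geo]]) (auto simp: indicator_def)
    also have "\<dots> \<le> 1" using sums_unique[OF geo[of 0]] by simp
    finally show "c x \<le> 1" .
  qed
  \<comment> \<open>At the first index \<open>n\<close> where the memberships differ, the terms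
    differ by \<open>(1/3) ^ Suc n\<close>, while the whole tail contributes at most half of that.
    Base 3 instead of 2 leaves this gap.\<close>
  have sep: "\<bar>c x - c y\<bar> \<ge> (1/3) ^ N / 2"
    if i: "i < N" "\<not> (x \<in> B i \<longleftrightarrow> y \<in> B i)" for x y i N
  proof -
    define d where "d i = (indicator (B i) x - indicator (B i) y) * (1/3::real) ^ Suc i" for i
    obtain n where n: "\<not> (x \<in> B n \<longleftrightarrow> y \<in> B n)" "\<And>j. j < n \<Longrightarrow> x \<in> B j \<longleftrightarrow> y \<in> B j"
      using i(2) exists_least_iff[of "\<lambda>i. \<not> (x \<in> B i \<longleftrightarrow> y \<in> B i)"] by blast
    have "n < N" using n(2)[of i] i by (metis linorder_neqE_nat order.strict_trans)
    have d: "summable d" unfolding d_def left_diff_distrib by (intro summable_diff summ)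
    have "c x - c y = suminf d"
      unfolding c_def d_def left_diff_distrib by (rule suminf_diff[OF summ summ])
    also have "\<dots> = (\<Sum>i. d (i + Suc n)) + sum d {..<Suc n}"
      by (rule suminf_split_initial_segment[OF d])
    also have "sum d {..<Suc n} = d n"
      using n(2) by (simp add: d_def indicator_def)
    finally have eq: "c x - c y = (\<Sum>i. d (i + Suc n)) + d n" .
    have le: "norm (d (i + Suc n)) \<le> (1/3) ^ Suc (i + Suc n)" for i
      by (auto simp: d_def indicator_def)
    have "norm (\<Sum>i. d (i + Suc n)) \<le> (\<Sum>i. (1/3) ^ Suc (i + Suc n))"
      by (rule norm_suminf_le[OF le sums_summable[OF geo]])
    also have "\<dots> = (1/3) ^ Suc n / 2" using sums_unique[OF geo] by metis
    finally have "\<bar>\<Sum>i. d (i + Suc n)\<bar> \<le> (1/3) ^ Suc n / 2" by simp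
    moreover have "\<bar>d n\<bar> = (1/3) ^ Suc n" using n(1) by (auto simp: d_def indicator_def)
    moreover have "(1/3) ^ N \<le> (1/3 :: real) ^ Suc n"
      using \<open>n < N\<close> by (intro power_decreasing) auto
    ultimately show ?thesis using eq by linarith
  qed
  have meas: "c \<in> borel_measurable borel"
    unfolding c_def using B by (intro borel_measurable_suminf) (auto intro!: borel_measurable_times borel_measurable_indicator)
  show ?thesis
  proof (intro exI[of _ c] conjI allI impI meas)
    fix \<epsilon> :: real assume "\<epsilon> > 0"
    from B'[OF this] obtain N where
      N: "\<forall>x\<in>K. \<exists>i<N. x \<in> B i \<and> (\<forall>y\<in>B i. \<forall>z\<in>B i. dist y z < \<epsilon>)" ..
    show "\<exists>\<delta>>0. \<forall>x\<in>K. \<forall>y\<in>K. \<bar>c x - c y\<bar> < \<delta> \<longrightarrow> dist x y < \<epsilon>"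
    proof (intro exI[of _ "(1/3) ^ N / 2"] conjI ballI impI)
      fix x y assume xy: "x \<in> K" "y \<in> K" "\<bar>c x - c y\<bar> < (1/3) ^ N / 2"
      obtain i where i: "i < N" "x \<in> B i" "\<forall>y\<in>B i. \<forall>z\<in>B i. dist y z < \<epsilon>"
        using N xy(1) by blast
      have "y \<in> B i"
      proof (rule ccontr)
        assume "y \<notin> B i"
        then have "\<bar>c x - c y\<bar> \<ge> (1/3) ^ N / 2" using i by (intro sep[of i]) auto
        then show False using xy(3) by linarith
      qed
      then show "dist x y < \<epsilon>" using i by blast
    qed simp
  qed (simp_all add: c01)
qed

text \<open>A weak limit of image measures lives on the closure of the codes, which may contain
  points that are not codes. There the inverse is a limit of points whose codes converge:
  compactness yields a limit, and separation makes it unique and continuous in the code.\<close>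

lemma inverse_code_extension:
  fixes K :: "'a::metric_space set" and c :: "'a \<Rightarrow> real"
  assumes "compact K"
    and sep: "\<And>\<epsilon>. \<epsilon> > 0 \<Longrightarrow> \<exists>\<delta>>0. \<forall>x\<in>K. \<forall>y\<in>K. \<bar>c x - c y\<bar> < \<delta> \<longrightarrow> dist x y < \<epsilon>"
  shows "\<exists>G. continuous_on (closure (c ` K)) G \<and> G ` closure (c ` K) \<subseteq> K \<and> (\<forall>x\<in>K. G (c x) = x)"
proof -
  \<comment> \<open>\<open>c x = t\<close> is not demanded, because \<open>c\<close> may be
    discontinuous at \<open>x\<close>.\<close>
  define R where "R t x \<longleftrightarrow> (\<exists>z. (\<forall>n. z n \<in> K) \<and> (\<lambda>n. c (z n)) \<longlonglongrightarrow> t \<and> z \<longlonglongrightarrow> x)" for t x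
  have ex: "\<exists>x\<in>K. R t x" if t: "t \<in> closure (c ` K)" for t
  proof -
    from t obtain u where u: "\<And>n. u n \<in> c ` K" "u \<longlonglongrightarrow> t"
      unfolding closure_sequential by blast
    then have "\<forall>n. \<exists>z. z \<in> K \<and> u n = c z" by blast
    then obtain z where z: "\<And>n. z n \<in> K" "\<And>n. u n = c (z n)" by metis
    obtain x r where x: "x \<in> K" "strict_mono (r :: nat \<Rightarrow> nat)" "(z \<circ> r) \<longlonglongrightarrow> x"
      using \<open>compact K\<close> z(1) unfolding compact_def by metis
    have "(\<lambda>n. c ((z \<circ> r) n)) \<longlonglongrightarrow> t"
      using LIMSEQ_subseq_LIMSEQ[OF u(2) x(2)] z(2) by (simp add: comp_def)
    then show ?thesis using x z(1) unfolding R_def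
      by (intro bexI[of _ x] exI[of _ "z \<circ> r"]) auto
  qed
  \<comment> \<open>Separation survives limits, with \<open><\<close> weakened to
    \<open>\<le>\<close>. One \<open>\<delta>\<close> serves all related pairs, which gives
    continuity of the selection \<open>G\<close> and also \<open>G (c x) = x\<close>.\<close>
  have close: "\<exists>\<delta>>0. \<forall>t t' x x'. R t x \<longrightarrow> R t' x' \<longrightarrow> \<bar>t - t'\<bar> < \<delta> \<longrightarrow> dist x x' \<le> \<epsilon>"
    if "\<epsilon> > 0" for \<epsilon>
  proof -
    from sep[OF that] obtain \<delta> where \<delta>: "\<delta> > 0"
      "\<And>x y. x \<in> K \<Longrightarrow> y \<in> K \<Longrightarrow> \<bar>c x - c y\<bar> < \<delta> \<Longrightarrow> dist x y < \<epsilon>" by blast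
    have "dist x x' \<le> \<epsilon>" if "R t x" "R t' x'" "\<bar>t - t'\<bar> < \<delta>" for t t' x x'
    proof -
      obtain z where z: "\<And>n. z n \<in> K" "(\<lambda>n. c (z n)) \<longlonglongrightarrow> t" "z \<longlonglongrightarrow> x"
        using \<open>R t x\<close> unfolding R_def by blast
      obtain z' where z': "\<And>n. z' n \<in> K" "(\<lambda>n. c (z' n)) \<longlonglongrightarrow> t'" "z' \<longlonglongrightarrow> x'"
        using \<open>R t' x'\<close> unfolding R_def by blast
      have "(\<lambda>n. \<bar>c (z n) - c (z' n)\<bar>) \<longlonglongrightarrow> \<bar>t - t'\<bar>"
        by (intro tendsto_intros z z')
      from order_tendstoD(2)[OF this that(3)]
      have "\<forall>\<^sub>F n in sequentially. dist (z n) (z' n) \<le> \<epsilon>"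
        by eventually_elim (use \<delta>(2) z(1) z'(1) in \<open>auto intro: less_imp_le\<close>)
      moreover have "(\<lambda>n. dist (z n) (z' n)) \<longlonglongrightarrow> dist x x'"
        by (intro tendsto_intros z z')
      ultimately show ?thesis
        by (intro tendsto_upperbound[of "\<lambda>n. dist (z n) (z' n)" _ sequentially]) auto
    qed
    then show ?thesis using \<delta>(1) by blast
  qed
  define G where "G t = (SOME x. x \<in> K \<and> R t x)" for t
  have G: "G t \<in> K" "R t (G t)" if "t \<in> closure (c ` K)" for t
    using someI_ex[of "\<lambda>x. x \<in> K \<and> R t x"] ex[OF that] unfolding G_def by blast+
  have "continuous_on (closure (c ` K)) G"
    unfolding continuous_on_iff
  proof (intro ballI allI impI)
    fix t \<epsilon> assume t: "t \<in> closure (c ` K)" and "(\<epsilon>::real) > 0"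
    then have "\<epsilon> / 2 > 0" by simp
    from close[OF this] obtain \<delta> where \<delta>: "\<delta> > 0"
      "\<forall>t t' x x'. R t x \<longrightarrow> R t' x' \<longrightarrow> \<bar>t - t'\<bar> < \<delta> \<longrightarrow> dist x x' \<le> \<epsilon> / 2" by (elim exE conjE)
    have "dist (G t') (G t) < \<epsilon>" if "t' \<in> closure (c ` K)" "dist t' t < \<delta>" for t'
      using \<delta>(2)[rule_format, OF G(2)[OF that(1)] G(2)[OF t]] that(2) \<open>\<epsilon> > 0\<close> by (simp add: dist_real_def)
    then show "\<exists>d>0. \<forall>x'\<in>closure (c ` K). dist x' t < d \<longrightarrow> dist (G x') (G t) < \<epsilon>"
      using \<delta>(1) by blast
  qed
  moreover have "G (c x) = x" if "x \<in> K" for x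
  proof -
    have c: "c x \<in> closure (c ` K)" using that closure_subset[of "c ` K"] by auto
    have "R (c x) x" unfolding R_def using that by (auto intro: exI[of _ "\<lambda>_. x"])
    \<comment> \<open>The constant sequence relates \<open>c x\<close> to \<open>x\<close>, and
      equal codes are closer than any \<open>\<delta>\<close>. The summand 0 fits
      \<open>field_le_epsilon\<close>.\<close>
    have "dist (G (c x)) x \<le> 0 + \<epsilon>" if "\<epsilon> > 0" for \<epsilon>
    proof -
      from close[OF that] obtain \<delta> where \<delta>: "\<delta> > 0"
        "\<forall>t t' x x'. R t x \<longrightarrow> R t' x' \<longrightarrow> \<bar>t - t'\<bar> < \<delta> \<longrightarrow> dist x x' \<le> \<epsilon>" by (elim exE conjE)
      show ?thesis using \<delta>(2)[rule_format, OF G(2)[OF c] \<open>R (c x) x\<close>] \<delta>(1) by simp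
    qed
    then have "dist (G (c x)) x \<le> 0" by (rule field_le_epsilon)
    then show ?thesis by simp
  qed
  ultimately show ?thesis using G(1) by (intro exI[of _ G]) (simp add: image_subset_iff)
qed

subsection \<open>Sequential compactness of the space of probability measures\<close>

lemma borel_probsD:
  assumes "\<gamma> \<in> borel_probs K"
  shows "prob_space \<gamma>" "sets \<gamma> = sets (restrict_space borel K)" "space \<gamma> = K"
  using assms sets_eq_imp_space_eq[of \<gamma> "restrict_space borel K"]
  by (auto simp: borel_probs_def space_restrict_space)

lemma continuous_measurable_borel_probs:
  assumes "\<gamma> \<in> borel_probs K" "continuous_on K h"
  shows "h \<in> borel_measurable \<gamma>"
  using borel_measurable_continuous_on_restrict[OF assms(2)]
  by (subst measurable_cong_sets[OF borel_probsD(2)[OF assms(1)] refl])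

lemma continuous_integrable_borel_probs:
  fixes h :: "'a::metric_space \<Rightarrow> real"
  assumes "compact K" "\<gamma> \<in> borel_probs K" "continuous_on K h"
  shows "integrable \<gamma> h"
proof -
  interpret prob_space \<gamma> using borel_probsD(1)[OF assms(2)] .
  obtain b where "\<And>x. x \<in> K \<Longrightarrow> norm (h x) \<le> b"
    using compact_imp_bounded[OF compact_continuous_image[OF assms(3,1)]]
    unfolding bounded_iff by auto
  then show ?thesis
    using continuous_measurable_borel_probs[OF assms(2,3)] borel_probsD(3)[OF assms(2)]
    by (intro integrable_const_bound[of _ b]) (auto intro!: AE_I2)
qed

text \<open>The code transports the measures to \<open>[0, 1]\<close>, where they are tight, so a
  subsequence converges weakly to some \<open>m\<close>. Since \<open>m\<close> is carried by the
  closed set \<open>C\<close>, the extended inverse \<open>G\<close> pushes it back to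
  \<open>K\<close>; a test function \<open>h\<close> is handled through \<open>h \<circ> G\<close>,
  extended to the line.\<close>

lemma borel_probs_seq_compact:
  fixes K :: "'a::metric_space set"
  assumes "compact K" and \<gamma>: "\<And>n. \<gamma> n \<in> borel_probs K"
  shows "\<exists>r \<gamma>'. strict_mono (r :: nat \<Rightarrow> nat) \<and> \<gamma>' \<in> borel_probs K \<and>
    (\<forall>h :: 'a \<Rightarrow> real. continuous_on K h \<longrightarrow> (\<lambda>n. \<integral>x. h x \<partial>\<gamma> (r n)) \<longlonglongrightarrow> (\<integral>x. h x \<partial>\<gamma>'))"
proof -
  interpret \<gamma>: prob_space "\<gamma> n" for n using borel_probsD(1)[OF \<gamma>] .
  have sp: "space (\<gamma> n) = K" for n by (rule borel_probsD(3)[OF \<gamma>])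
  obtain x0 where "x0 \<in> K" using \<gamma>.not_empty[of 0] sp by auto
  obtain c :: "'a \<Rightarrow> real" where c: "c \<in> borel_measurable borel" "\<And>x. 0 \<le> c x \<and> c x \<le> 1"
    and sep: "\<And>\<epsilon>. \<epsilon> > 0 \<Longrightarrow> \<exists>\<delta>>0. \<forall>x\<in>K. \<forall>y\<in>K. \<bar>c x - c y\<bar> < \<delta> \<longrightarrow> dist x y < \<epsilon>"
    using compact_Borel_code[OF \<open>compact K\<close>] by auto
  define C where "C = closure (c ` K)"
  obtain G where G: "continuous_on C G" "\<And>t. t \<in> C \<Longrightarrow> G t \<in> K" "\<And>x. x \<in> K \<Longrightarrow> G (c x) = x"
    using inverse_code_extension[OF \<open>compact K\<close> sep] unfolding C_def by blast
  have c_meas [measurable]: "c \<in> borel_measurable (\<gamma> n)" for n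
    using measurable_restrict_space1[OF c(1), of K]
    by (subst measurable_cong_sets[OF borel_probsD(2)[OF \<gamma>] refl])
  define \<mu> where "\<mu> n = distr (\<gamma> n) borel c" for n
  have \<mu>: "real_distribution (\<mu> n)" for n
    unfolding \<mu>_def by (rule \<gamma>.real_distribution_distr) simp
  \<comment> \<open>Tightness is formulated with intervals open on the left, so the left end has to
    lie below the possible code value 0.\<close>
  have "measure (\<mu> n) {-1<..1} = 1" for n
  proof -
    have "-1 < c x" for x using c(2)[of x] by linarith
    then have "c -` {-1<..1} \<inter> space (\<gamma> n) = space (\<gamma> n)" using c(2) by auto
    then show ?thesis unfolding \<mu>_def by (simp add: measure_distr \<gamma>.prob_space)
  qed
  then have "tight \<mu>"
    unfolding tight_def using \<mu> by (intro conjI allI impI exI[of _ "-1"] exI[of _ 1]) auto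
  from tight_imp_convergent_subsubsequence[OF this strict_mono_id]
  obtain r m where r: "strict_mono (r :: nat \<Rightarrow> nat)" and m: "real_distribution m"
    and conv: "weak_conv_m (\<mu> \<circ> r) m" by (auto simp: comp_def)
  interpret m: real_distribution m by fact
  have \<mu>r: "real_distribution ((\<mu> \<circ> r) n)" for n by (simp add: \<mu>)
  have lim: "(\<lambda>n. \<integral>x. H (c x) \<partial>\<gamma> (r n)) \<longlonglongrightarrow> (\<integral>t. H t \<partial>m)"
    if H: "continuous_on UNIV H" "\<And>x. \<bar>H x\<bar> \<le> b" for H :: "real \<Rightarrow> real" and b
  proof -
    have "(\<lambda>n. integral\<^sup>L ((\<mu> \<circ> r) n) H) \<longlonglongrightarrow> integral\<^sup>L m H"
      using H by (intro weak_conv_imp_integral_bdd_continuous_conv[OF \<mu>r m conv, of _ b])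
        (auto simp: continuous_on_eq_continuous_at)
    moreover have "integral\<^sup>L ((\<mu> \<circ> r) n) H = (\<integral>x. H (c x) \<partial>\<gamma> (r n))" for n
      unfolding \<mu>_def comp_def using borel_measurable_continuous_onI[OF H(1)]
      by (intro integral_distr) auto
    ultimately show ?thesis by simp
  qed
  have "C \<noteq> {}" using \<open>x0 \<in> K\<close> closure_subset[of "c ` K"] by (auto simp: C_def)
  have "closed C" by (simp add: C_def)
  have cC: "c x \<in> C" if "x \<in> K" for x using that closure_subset[of "c ` K"] by (auto simp: C_def)
  \<comment> \<open>A bounded continuous function vanishing exactly on \<open>C\<close>: its
    integrals along the sequence are 0, hence so is its integral under \<open>m\<close>.\<close>
  define d where "d t = min 1 (infdist t C)" for t
  have d: "continuous_on UNIV d" "\<And>t. \<bar>d t\<bar> \<le> 1"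
    unfolding d_def by (intro continuous_intros) (auto simp: infdist_nonneg)
  have "(\<integral>x. d (c x) \<partial>\<gamma> (r n)) = 0" for n
    by (subst Bochner_Integration.integral_cong[OF refl, of _ _ "\<lambda>_. 0"])
       (auto simp: d_def sp cC)
  with lim[OF d] have "(\<integral>t. d t \<partial>m) = 0" by (simp add: LIMSEQ_const_iff)
  moreover have "d \<in> borel_measurable m"
    using borel_measurable_continuous_onI[OF d(1)] by simp
  moreover from this have "integrable m d"
    by (intro m.integrable_const_bound[of _ 1]) (use d in auto)
  moreover have "0 \<le> d t" for t by (simp add: d_def infdist_nonneg)
  ultimately have "AE t in m. d t = 0"
    by (subst integral_nonneg_eq_0_iff_AE[symmetric]) auto
  then have AE: "AE t in m. t \<in> C"
    using in_closed_iff_infdist_zero[OF \<open>closed C\<close> \<open>C \<noteq> {}\<close>] by (auto simp: d_def min_def split: if_splits)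
  define G' where "G' t = (if t \<in> C then G t else x0)" for t
  have G'_meas: "G' \<in> measurable m (restrict_space borel K)"
  proof (rule measurable_restrict_space2)
    show "G' \<in> space m \<rightarrow> K" using G(2) \<open>x0 \<in> K\<close> by (auto simp: G'_def)
    have "G' \<in> borel_measurable borel"
      unfolding G'_def using borel_measurable_continuous_on_restrict[OF G(1)] \<open>closed C\<close>
      by (subst measurable_If_restrict_space_iff) auto
    then show "G' \<in> borel_measurable m" by simp
  qed
  define \<gamma>' where "\<gamma>' = distr m (restrict_space borel K) G'"
  have "\<gamma>' \<in> borel_probs K"
    using m.prob_space_distr[OF G'_meas] by (auto simp: borel_probs_def \<gamma>'_def)
  moreover have "(\<lambda>n. \<integral>x. h x \<partial>\<gamma> (r n)) \<longlonglongrightarrow> (\<integral>x. h x \<partial>\<gamma>')"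
    if h: "continuous_on K h" for h :: "'a \<Rightarrow> real"
  proof -
    obtain b where b: "\<And>x. x \<in> K \<Longrightarrow> norm (h x) \<le> b" "b \<ge> 0"
      using compact_imp_bounded[OF compact_continuous_image[OF h \<open>compact K\<close>]]
      unfolding bounded_pos by (auto dest: less_imp_le)
    have hG: "continuous_on C (\<lambda>t. h (G t))"
      by (rule continuous_on_compose2[OF h G(1)]) (use G(2) in auto)
    \<comment> \<open>Tietze's theorem keeps the bound \<open>b\<close>; weak convergence applies to
      bounded continuous functions on the whole line.\<close>
    obtain H where H: "continuous_on UNIV H" "\<And>t. t \<in> C \<Longrightarrow> H t = h (G t)" "\<And>t. norm (H t) \<le> b"
      using Tietze[OF hG, of UNIV b] \<open>closed C\<close> b G(2) by (metis UNIV_I subtopology_UNIV closed_closedin)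
    have "(\<integral>x. h x \<partial>\<gamma>') = (\<integral>t. h (G' t) \<partial>m)"
      unfolding \<gamma>'_def using borel_measurable_continuous_on_restrict[OF h]
      by (rule integral_distr[OF G'_meas])
    also have "\<dots> = (\<integral>t. H t \<partial>m)"
    proof (rule integral_cong_AE)
      show "(\<lambda>t. h (G' t)) \<in> borel_measurable m"
        using measurable_comp[OF G'_meas borel_measurable_continuous_on_restrict[OF h]]
        by (simp add: comp_def)
      show "H \<in> borel_measurable m" using borel_measurable_continuous_onI[OF H(1)] by simp
      show "AE t in m. h (G' t) = H t" using AE by eventually_elim (simp add: G'_def H(2))
    qed
    finally have "(\<lambda>n. \<integral>x. H (c x) \<partial>\<gamma> (r n)) \<longlonglongrightarrow> (\<integral>x. h x \<partial>\<gamma>')"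
      using lim[OF H(1), of b] H(3) by simp
    moreover have "(\<integral>x. H (c x) \<partial>\<gamma> (r n)) = (\<integral>x. h x \<partial>\<gamma> (r n))" for n
      by (rule Bochner_Integration.integral_cong) (auto simp: sp H(2) cC G(3))
    ultimately show ?thesis by simp
  qed
  ultimately show ?thesis using r by blast
qed

subsection \<open>The metric on measures and stationarity\<close>

lemma (in prob_space) abs_integral_le_const:
  fixes h :: "'a \<Rightarrow> real"
  assumes "\<And>x. x \<in> space M \<Longrightarrow> \<bar>h x\<bar> \<le> b" "b \<ge> 0"
  shows "\<bar>\<integral>x. h x \<partial>M\<bar> \<le> b"
proof -
  have "\<bar>\<integral>x. h x \<partial>M\<bar> \<le> (\<integral>x. \<bar>h x\<bar> \<partial>M)" by (rule integral_abs_bound)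
  also have "\<dots> \<le> (\<integral>x. b \<partial>M)"
    using assms by (intro integral_mono') auto
  finally show ?thesis by (simp add: prob_space)
qed

lemma dense_lipschitz_seqD:
  assumes "dense_lipschitz_seq X q"
  shows "continuous_on X (q (Suc j))" "x \<in> X \<Longrightarrow> \<bar>q (Suc j) x\<bar> \<le> 1"
proof -
  have *: "(\<exists>L. L-lipschitz_on X (q (Suc j))) \<and> (\<forall>x\<in>X. \<bar>q (Suc j) x\<bar> \<le> 1)"
    using assms by (simp add: dense_lipschitz_seq_def)
  then show "continuous_on X (q (Suc j))" by (auto intro: lipschitz_on_continuous_on)
  show "x \<in> X \<Longrightarrow> \<bar>q (Suc j) x\<bar> \<le> 1" using * by simp
qed

lemma abs_integral_dense_lipschitz_seq_le:
  assumes "dense_lipschitz_seq K q" "\<gamma> \<in> borel_probs K"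
  shows "\<bar>\<integral>x. q (Suc j) x \<partial>\<gamma>\<bar> \<le> 1"
  using borel_probsD(3)[OF assms(2)] dense_lipschitz_seqD(2)[OF assms(1)]
  by (intro prob_space.abs_integral_le_const[OF borel_probsD(1)[OF assms(2)]]) auto

text \<open>Both integrals lie in \<open>[-1, 1]\<close>, so the difference costs a factor 2, which
  cancels one of the halves. This geometric majorant serves summability, the bound on
  \<open>rho\<close> and the limit theorem below.\<close>

lemma rho_term_le:
  assumes "dense_lipschitz_seq K q" "\<gamma> \<in> borel_probs K" "\<gamma>' \<in> borel_probs K"
  shows "\<bar>(1 / 2) ^ Suc j * \<bar>(\<integral>x. q (Suc j) x \<partial>\<gamma>) - (\<integral>x. q (Suc j) x \<partial>\<gamma>')\<bar>\<bar> \<le> (1 / 2) ^ j"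
  using abs_integral_dense_lipschitz_seq_le[OF assms(1,2), of j]
    abs_integral_dense_lipschitz_seq_le[OF assms(1,3), of j]
  by (simp add: abs_mult)

lemma summable_rho:
  assumes "dense_lipschitz_seq K q" "\<gamma> \<in> borel_probs K" "\<gamma>' \<in> borel_probs K"
  shows "summable (\<lambda>j. (1 / 2) ^ Suc j * \<bar>(\<integral>x. q (Suc j) x \<partial>\<gamma>) - (\<integral>x. q (Suc j) x \<partial>\<gamma>')\<bar>)"
  by (rule summable_comparison_test[OF _ summable_geometric[of "1 / 2 :: real"]])
     (use rho_term_le[OF assms] in \<open>auto intro!: exI[of _ 0]\<close>)

lemma rho_nonneg:
  assumes "dense_lipschitz_seq K q" "\<gamma> \<in> borel_probs K" "\<gamma>' \<in> borel_probs K"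
  shows "0 \<le> rho q \<gamma> \<gamma>'"
  unfolding rho_def by (rule suminf_nonneg[OF summable_rho[OF assms]]) simp

lemma rho_le_2:
  assumes "dense_lipschitz_seq K q" "\<gamma> \<in> borel_probs K" "\<gamma>' \<in> borel_probs K"
  shows "rho q \<gamma> \<gamma>' \<le> 2"
proof -
  have "rho q \<gamma> \<gamma>' \<le> (\<Sum>j. (1 / 2) ^ j)"
    unfolding rho_def
    by (rule suminf_le[OF _ summable_rho[OF assms] summable_geometric])
       (use rho_term_le[OF assms] in auto)
  then show ?thesis by (simp add: suminf_geometric)
qed

lemma rho_tendsto_0:
  assumes q: "dense_lipschitz_seq K q" and "\<And>n. \<gamma> n \<in> borel_probs K" "\<gamma>' \<in> borel_probs K"
    and lim: "\<And>j. (\<lambda>n. \<integral>x. q (Suc j) x \<partial>\<gamma> n) \<longlonglongrightarrow> (\<integral>x. q (Suc j) x \<partial>\<gamma>')"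
  shows "(\<lambda>n. rho q (\<gamma> n) \<gamma>') \<longlonglongrightarrow> 0"
proof -
  let ?a = "\<lambda>j n. (1 / 2) ^ Suc j * \<bar>(\<integral>x. q (Suc j) x \<partial>\<gamma> n) - (\<integral>x. q (Suc j) x \<partial>\<gamma>')\<bar>"
  have "(\<lambda>n. ?a j n) \<longlonglongrightarrow> 0" for j
    by (rule tendsto_eq_rhs[OF tendsto_mult[OF tendsto_const
          tendsto_rabs[OF tendsto_diff[OF lim tendsto_const]]]]) simp
  moreover have "\<forall>\<^sub>F (j, n) in at_top \<times>\<^sub>F sequentially. norm (?a j n) \<le> (1 / 2) ^ j"
    by (rule always_eventually) (use rho_term_le[OF q assms(2,3)] in auto)
  ultimately have "(\<lambda>n. \<Sum>j. ?a j n) \<longlonglongrightarrow> (\<Sum>j. 0)"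
    using tannerys_theorem[of ?a "\<lambda>_. 0" sequentially "\<lambda>j. (1 / 2) ^ j"] summable_geometric[of "1 / 2 :: real"]
    by auto
  then show ?thesis by (simp add: rho_def)
qed

lemma rho_set_le_rho:
  assumes "dense_lipschitz_seq K q" "\<gamma> \<in> borel_probs K" "W \<subseteq> borel_probs K" "\<gamma>' \<in> W"
  shows "rho_set q \<gamma> W \<le> rho q \<gamma> \<gamma>'"
  unfolding rho_set_def
  by (rule cINF_lower[OF _ assms(4)]) (use assms in \<open>auto intro!: bdd_belowI2[of _ 0] rho_nonneg[OF assms(1,2)]\<close>)

section \<open>The drift and approximate stationarity\<close>

text \<open>This is the function \<open>L\<phi>\<close> of the idea, the one-step generator of the
  controlled chain. Its body is the integrand of \<open>stationary_measures\<close>.\<close>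

definition drift :: "('y \<times> 'u \<times> 's \<Rightarrow> 'y) \<Rightarrow> 's measure \<Rightarrow> ('y \<Rightarrow> real) \<Rightarrow> 'y \<times> 'u \<Rightarrow> real" where
  "drift f \<mu> \<phi> = (\<lambda>(y, u). (\<integral>s. \<phi> (f (y, u, s)) \<partial>\<mu>) - \<phi> y)"

lemma continuous_on_compact_bound:
  fixes h :: "'a::metric_space \<Rightarrow> real"
  assumes "compact K" "continuous_on K h"
  shows "\<exists>b>0. \<forall>x\<in>K. \<bar>h x\<bar> \<le> b"
  using compact_imp_bounded[OF compact_continuous_image[OF assms(2,1)]]
  unfolding bounded_pos by auto

text \<open>Dominated convergence under \<open>\<mu>\<close> along sequences, with the bound of
  \<open>\<phi>\<close> on the compact set \<open>Y\<close> as constant majorant. Continuity allows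
  drifts as test functions for weak limits.\<close>

lemma continuous_on_drift:
  fixes Y :: "'y::metric_space set" and U :: "'u::metric_space set" and S :: "'s::metric_space set"
  assumes "compact Y" and f: "continuous_on (Y \<times> U \<times> S) f" "f ` (Y \<times> U \<times> S) \<subseteq> Y"
    and \<mu>: "\<mu> \<in> borel_probs S" and \<phi>: "continuous_on Y \<phi>"
  shows "continuous_on (Y \<times> U) (drift f \<mu> \<phi>)"
proof (rule continuous_on_sequentiallyI)
  fix z :: "nat \<Rightarrow> 'y \<times> 'u" and a
  assume z: "\<forall>n. z n \<in> Y \<times> U" and a: "a \<in> Y \<times> U" and "z \<longlonglongrightarrow> a"
  interpret \<mu>: prob_space \<mu> using borel_probsD(1)[OF \<mu>] .
  have sp: "space \<mu> = S" by (rule borel_probsD(3)[OF \<mu>])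
  have fst: "(\<lambda>n. fst (z n)) \<longlonglongrightarrow> fst a" and snd: "(\<lambda>n. snd (z n)) \<longlonglongrightarrow> snd a"
    using \<open>z \<longlonglongrightarrow> a\<close> by (auto intro: tendsto_fst tendsto_snd)
  have zY: "fst (z n) \<in> Y" "snd (z n) \<in> U" for n using z by (auto simp: mem_Times_iff)
  have aY: "fst a \<in> Y" "snd a \<in> U" using a by (auto simp: mem_Times_iff)
  have \<phi>f: "continuous_on (Y \<times> U \<times> S) (\<lambda>p. \<phi> (f p))"
    by (rule continuous_on_compose2[OF \<phi> f])
  obtain b where b: "b > 0" "\<forall>y\<in>Y. \<bar>\<phi> y\<bar> \<le> b"
    using continuous_on_compact_bound[OF \<open>compact Y\<close> \<phi>] by blast
  have meas: "(\<lambda>s. \<phi> (f (y, u, s))) \<in> borel_measurable \<mu>" if "y \<in> Y" "u \<in> U" for y u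
    by (intro continuous_measurable_borel_probs[OF \<mu>] continuous_on_compose2[OF \<phi>f])
       (use that in \<open>auto intro!: continuous_intros\<close>)
  have "(\<lambda>n. \<integral>s. \<phi> (f (fst (z n), snd (z n), s)) \<partial>\<mu>) \<longlonglongrightarrow> (\<integral>s. \<phi> (f (fst a, snd a, s)) \<partial>\<mu>)"
  proof (rule integral_dominated_convergence[where w="\<lambda>_. b"])
    show "AE s in \<mu>. (\<lambda>n. \<phi> (f (fst (z n), snd (z n), s))) \<longlonglongrightarrow> \<phi> (f (fst a, snd a, s))"
    proof (rule AE_I2)
      fix s assume "s \<in> space \<mu>"
      then have "s \<in> S" by (simp add: sp)
      have "(\<lambda>n. (fst (z n), snd (z n), s)) \<longlonglongrightarrow> (fst a, snd a, s)"
        by (intro tendsto_intros fst snd)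
      then show "(\<lambda>n. \<phi> (f (fst (z n), snd (z n), s))) \<longlonglongrightarrow> \<phi> (f (fst a, snd a, s))"
        by (rule continuous_on_tendsto_compose[OF \<phi>f]) (use zY aY \<open>s \<in> S\<close> in auto)
    qed
    show "AE s in \<mu>. norm (\<phi> (f (fst (z n), snd (z n), s))) \<le> b" for n
      using zY[of n] f(2) b(2) by (intro AE_I2) (auto simp: sp image_subset_iff)
  qed (use meas zY aY in auto)
  moreover have "(\<lambda>n. \<phi> (fst (z n))) \<longlonglongrightarrow> \<phi> (fst a)"
    by (rule continuous_on_tendsto_compose[OF \<phi> fst]) (use zY aY in auto)
  ultimately show "(\<lambda>n. drift f \<mu> \<phi> (z n)) \<longlonglongrightarrow> drift f \<mu> \<phi> a"
    unfolding drift_def case_prod_unfold by (rule tendsto_diff)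
qed

lemma integrable_one_step:
  fixes Y :: "'y::metric_space set" and U :: "'u::metric_space set" and S :: "'s::metric_space set"
    and \<phi> :: "'y \<Rightarrow> real"
  assumes "f ` (Y \<times> U \<times> S) \<subseteq> Y" "continuous_on (Y \<times> U \<times> S) f"
    and "\<mu> \<in> borel_probs S" "compact S" "continuous_on Y \<phi>" "y \<in> Y" "u \<in> U"
  shows "integrable \<mu> (\<lambda>s. \<phi> (f (y, u, s)))"
proof (rule continuous_integrable_borel_probs[OF \<open>compact S\<close> assms(3)])
  have "continuous_on S (\<lambda>s. f (y, u, s))"
    by (rule continuous_on_compose2[OF assms(2)]) (use assms in \<open>auto intro!: continuous_intros\<close>)
  then show "continuous_on S (\<lambda>s. \<phi> (f (y, u, s)))"
    by (rule continuous_on_compose2[OF assms(5)]) (use assms in auto)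
qed

text \<open>A function of \<open>y\<close> alone, scaled into the unit ball, is uniformly
  approximated by some \<open>q j\<close> on \<open>Y \<times> U\<close>; freezing the control at
  \<open>u0\<close> turns this into an approximation on \<open>Y\<close>. The drift is linear and at
  most doubles the uniform error.\<close>

lemma stationary_of_dense:
  fixes Y :: "'y::metric_space set" and U :: "'u::metric_space set" and S :: "'s::metric_space set"
    and q :: "nat \<Rightarrow> 'y \<times> 'u \<Rightarrow> real"
  assumes K: "compact Y" "compact U" "compact S"
    and f: "continuous_on (Y \<times> U \<times> S) f" "f ` (Y \<times> U \<times> S) \<subseteq> Y"
    and \<mu>: "\<mu> \<in> borel_probs S" and q: "dense_lipschitz_seq (Y \<times> U) q" and "u0 \<in> U"
    and \<gamma>: "\<gamma> \<in> borel_probs (Y \<times> U)"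
    and zero: "\<And>k. (\<integral>x. drift f \<mu> (\<lambda>y. q (Suc k) (y, u0)) x \<partial>\<gamma>) = 0"
  shows "\<gamma> \<in> stationary_measures Y U f \<mu>"
proof -
  interpret \<mu>: prob_space \<mu> using borel_probsD(1)[OF \<mu>] .
  interpret \<gamma>: prob_space \<gamma> using borel_probsD(1)[OF \<gamma>] .
  have sp: "space \<mu> = S" "space \<gamma> = Y \<times> U" by (rule borel_probsD(3)[OF \<mu>], rule borel_probsD(3)[OF \<gamma>])
  have "(\<integral>x. drift f \<mu> \<phi> x \<partial>\<gamma>) = 0" if \<phi>: "continuous_on Y \<phi>" for \<phi> :: "'y \<Rightarrow> real"
  proof -
    obtain b where b: "b > 0" "\<forall>y\<in>Y. \<bar>\<phi> y\<bar> \<le> b"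
      using continuous_on_compact_bound[OF K(1) \<phi>] by blast
    have "\<bar>\<integral>x. drift f \<mu> \<phi> x \<partial>\<gamma>\<bar> \<le> 0 + \<epsilon>" if "\<epsilon> > 0" for \<epsilon>
    proof -
      \<comment> \<open>Undoing the scaling multiplies the error by \<open>b\<close>, and the drift
        evaluates the function both under the integral and at \<open>y\<close>: together
        \<open>b * e + b * e = \<epsilon>\<close>.\<close>
      define e where "e = \<epsilon> / (2 * b)"
      have "e > 0" using that b by (simp add: e_def)
      have "continuous_on (Y \<times> U) (\<lambda>x. \<phi> (fst x) / b)"
        using b by (intro continuous_intros continuous_on_compose2[OF \<phi>]) auto
      moreover have "\<forall>x\<in>Y \<times> U. \<bar>\<phi> (fst x) / b\<bar> \<le> 1" using b by (auto simp: divide_simps)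
      ultimately obtain j where j: "j \<ge> 1" "\<forall>x\<in>Y \<times> U. \<bar>q j x - \<phi> (fst x) / b\<bar> < e"
        using q \<open>e > 0\<close> unfolding dense_lipschitz_seq_def by (metis (no_types, lifting))
      define \<psi> where "\<psi> y = q j (y, u0)" for y
      obtain k where k: "j = Suc k" using j(1) by (cases j) auto
      then have \<psi>_eq: "\<psi> = (\<lambda>y. q (Suc k) (y, u0))" by (simp add: \<psi>_def fun_eq_iff)
      have \<psi>: "continuous_on Y \<psi>" unfolding \<psi>_def k
        by (rule continuous_on_compose2[OF dense_lipschitz_seqD(1)[OF q]])
           (use \<open>u0 \<in> U\<close> in \<open>auto intro!: continuous_intros\<close>)
      have close: "\<bar>\<phi> y - b * \<psi> y\<bar> \<le> b * e" if "y \<in> Y" for y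
      proof -
        have "\<bar>\<psi> y - \<phi> y / b\<bar> < e" using j(2) that \<open>u0 \<in> U\<close> by (auto simp: \<psi>_def)
        then have "b * \<bar>\<psi> y - \<phi> y / b\<bar> \<le> b * e" using b(1) by simp
        also have "b * \<bar>\<psi> y - \<phi> y / b\<bar> = \<bar>b * (\<psi> y - \<phi> y / b)\<bar>" using b(1) by (simp add: abs_mult)
        also have "b * (\<psi> y - \<phi> y / b) = b * \<psi> y - \<phi> y" using b(1) by (simp add: field_simps)
        finally show ?thesis by (simp add: abs_minus_commute)
      qed
      have d: "\<bar>drift f \<mu> \<phi> x - b * drift f \<mu> \<psi> x\<bar> \<le> \<epsilon>" if "x \<in> Y \<times> U" for x
      proof -
        obtain y u where x: "x = (y, u)" "y \<in> Y" "u \<in> U" using \<open>x \<in> Y \<times> U\<close> by blast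
        have "drift f \<mu> \<phi> x - b * drift f \<mu> \<psi> x
            = (\<integral>s. \<phi> (f (y, u, s)) - b * \<psi> (f (y, u, s)) \<partial>\<mu>) - (\<phi> y - b * \<psi> y)"
          using integrable_one_step[OF f(2,1) \<mu> K(3) \<phi> x(2,3)] integrable_one_step[OF f(2,1) \<mu> K(3) \<psi> x(2,3)]
          by (simp add: drift_def x(1) algebra_simps)
        moreover have "\<bar>\<integral>s. \<phi> (f (y, u, s)) - b * \<psi> (f (y, u, s)) \<partial>\<mu>\<bar> \<le> b * e"
          using x f(2) b(1) \<open>e > 0\<close>
          by (intro \<mu>.abs_integral_le_const close) (auto simp: sp image_subset_iff)
        moreover have "b * e + b * e = \<epsilon>" using b(1) by (simp add: e_def)
        ultimately show ?thesis using close[OF x(2)] by linarith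
      qed
      have "integrable \<gamma> (drift f \<mu> \<phi>)" "integrable \<gamma> (drift f \<mu> \<psi>)"
        using continuous_integrable_borel_probs[OF compact_Times[OF K(1,2)] \<gamma>]
          continuous_on_drift[OF K(1) f \<mu>] \<phi> \<psi> by auto
      then have "(\<integral>x. drift f \<mu> \<phi> x - b * drift f \<mu> \<psi> x \<partial>\<gamma>) = (\<integral>x. drift f \<mu> \<phi> x \<partial>\<gamma>)"
        using zero[of k] \<psi>_eq by simp
      moreover have "\<bar>\<integral>x. drift f \<mu> \<phi> x - b * drift f \<mu> \<psi> x \<partial>\<gamma>\<bar> \<le> \<epsilon>"
        using d \<open>\<epsilon> > 0\<close> by (intro \<gamma>.abs_integral_le_const) (auto simp: sp)
      ultimately show ?thesis by simp
    qed
    then have "\<bar>\<integral>x. drift f \<mu> \<phi> x \<partial>\<gamma>\<bar> \<le> 0" by (rule field_le_epsilon)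
    then show ?thesis by simp
  qed
  then show ?thesis using \<gamma> by (simp add: stationary_measures_def drift_def)
qed

text \<open>If every \<open>N\<close> failed, the counterexamples would have a weakly convergent
  subsequence; its limit annihilates all test drifts, so it is stationary, and \<open>rho\<close> to
  it tends to 0. \<open>N\<close> is both the number of tests and the scale of the tolerance, which
  yields a single sequence. The existential conclusion makes sense before stationary measures are
  known to exist.\<close>

lemma near_stationary:
  fixes Y :: "'y::metric_space set" and U :: "'u::metric_space set" and S :: "'s::metric_space set"
    and q :: "nat \<Rightarrow> 'y \<times> 'u \<Rightarrow> real"
  assumes K: "compact Y" "compact U" "compact S"
    and f: "continuous_on (Y \<times> U \<times> S) f" "f ` (Y \<times> U \<times> S) \<subseteq> Y"
    and \<mu>: "\<mu> \<in> borel_probs S" and q: "dense_lipschitz_seq (Y \<times> U) q" and "u0 \<in> U" and "\<epsilon> > 0"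
  shows "\<exists>N. \<forall>\<gamma>\<in>borel_probs (Y \<times> U).
    (\<forall>k<N. \<bar>\<integral>x. drift f \<mu> (\<lambda>y. q (Suc k) (y, u0)) x \<partial>\<gamma>\<bar> < 1 / real (Suc N)) \<longrightarrow>
    (\<exists>\<gamma>'\<in>stationary_measures Y U f \<mu>. rho q \<gamma> \<gamma>' < \<epsilon>)"
proof (rule ccontr)
  define L where "L k = drift f \<mu> (\<lambda>y. q (Suc k) (y, u0))" for k
  assume "\<not> ?thesis"
  then have "\<forall>N. \<exists>\<gamma>. \<gamma> \<in> borel_probs (Y \<times> U) \<and> (\<forall>k<N. \<bar>\<integral>x. L k x \<partial>\<gamma>\<bar> < 1 / real (Suc N)) \<and>
      (\<forall>\<gamma>'\<in>stationary_measures Y U f \<mu>. \<not> rho q \<gamma> \<gamma>' < \<epsilon>)"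
    unfolding L_def by (simp only: not_ex not_all Ball_def Bex_def not_imp) blast
  from choice[OF this] obtain \<gamma> where \<gamma>: "\<And>N. \<gamma> N \<in> borel_probs (Y \<times> U)"
    and small: "\<And>N k. k < N \<Longrightarrow> \<bar>\<integral>x. L k x \<partial>\<gamma> N\<bar> < 1 / real (Suc N)"
    and far: "\<And>N \<gamma>'. \<gamma>' \<in> stationary_measures Y U f \<mu> \<Longrightarrow> \<not> rho q (\<gamma> N) \<gamma>' < \<epsilon>"
    by auto
  from borel_probs_seq_compact[of _ \<gamma>, OF compact_Times[OF K(1,2)] \<gamma>] obtain r \<gamma>' where
    r: "strict_mono (r :: nat \<Rightarrow> nat)" and \<gamma>': "\<gamma>' \<in> borel_probs (Y \<times> U)"
    and conv: "\<And>h :: _ \<Rightarrow> real. continuous_on (Y \<times> U) h \<Longrightarrow>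
        (\<lambda>n. \<integral>x. h x \<partial>\<gamma> (r n)) \<longlonglongrightarrow> (\<integral>x. h x \<partial>\<gamma>')"
    by auto
  have "(\<integral>x. L k x \<partial>\<gamma>') = 0" for k
  proof -
    have "continuous_on Y (\<lambda>y. q (Suc k) (y, u0))"
      by (rule continuous_on_compose2[OF dense_lipschitz_seqD(1)[OF q]])
         (use \<open>u0 \<in> U\<close> in \<open>auto intro!: continuous_intros\<close>)
    then have "continuous_on (Y \<times> U) (L k)"
      unfolding L_def by (rule continuous_on_drift[OF K(1) f \<mu>])
    note * = conv[OF this]
    have "(\<lambda>N. \<integral>x. L k x \<partial>\<gamma> N) \<longlonglongrightarrow> 0"
    proof (rule Lim_null_comparison)
      \<comment> \<open>Test \<open>k\<close> is among the first \<open>N\<close> only once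
        \<open>N > k\<close>.\<close>
      show "\<forall>\<^sub>F N in sequentially. norm (\<integral>x. L k x \<partial>\<gamma> N) \<le> 1 / real (Suc N)"
        using eventually_gt_at_top[of k] by eventually_elim (use small in \<open>auto intro: less_imp_le\<close>)
      show "(\<lambda>N. 1 / real (Suc N)) \<longlonglongrightarrow> 0" using LIMSEQ_inverse_real_of_nat by (simp add: inverse_eq_divide)
    qed
    from LIMSEQ_subseq_LIMSEQ[OF this r] have "(\<lambda>n. \<integral>x. L k x \<partial>\<gamma> (r n)) \<longlonglongrightarrow> 0"
      by (simp add: comp_def)
    with * show ?thesis by (rule LIMSEQ_unique)
  qed
  then have stat: "\<gamma>' \<in> stationary_measures Y U f \<mu>"
    unfolding L_def by (rule stationary_of_dense[OF K f \<mu> q \<open>u0 \<in> U\<close> \<gamma>'])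
  have "(\<lambda>n. rho q (\<gamma> (r n)) \<gamma>') \<longlonglongrightarrow> 0"
    by (rule rho_tendsto_0[OF q \<gamma> \<gamma>' conv[OF dense_lipschitz_seqD(1)[OF q]]])
  from order_tendstoD(2)[OF this \<open>\<epsilon> > 0\<close>] show False
    using far[OF stat] by (auto dest: eventually_happens)
qed

subsection \<open>Occupational measures and orthogonal increments\<close>

text \<open>The image of the uniform distribution on the times below \<open>T\<close>: normalization
  and integrals reduce to a finite uniform law. The space of that law is all of \<open>nat\<close>,
  hence the condition on \<open>z\<close> at every time.\<close>

lemma occ_measure_eq_distr:
  assumes "T \<ge> 1" and z: "\<And>t. z t \<in> X"
  shows "occ_measure X T z = distr (measure_pmf (pmf_of_set {..<T})) (restrict_space borel X) z"
proof (rule measure_eqI)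
  have meas: "z \<in> measurable (measure_pmf (pmf_of_set {..<T})) (restrict_space borel X)"
    using z by (auto simp: space_restrict_space)
  have ne: "{..<T} \<noteq> {}" "finite {..<T}" using \<open>T \<ge> 1\<close> by (auto simp: lessThan_empty_iff)
  fix Q assume "Q \<in> sets (occ_measure X T z)"
  then have Q: "Q \<in> sets (restrict_space borel X)" by (simp add: sets_occ_measure)
  have "(\<Sum>t<T. indicator Q (z t) :: real) = (\<Sum>t<T. indicator (z -` Q) t)"
    by (simp add: indicator_def)
  also have "\<dots> = real (card ({..<T} \<inter> z -` Q))"
    by (simp add: indicator_def sum.If_cases Int_def)
  finally show "emeasure (occ_measure X T z) Q
      = emeasure (distr (measure_pmf (pmf_of_set {..<T})) (restrict_space borel X) z) Q"
    using \<open>T \<ge> 1\<close> by (simp add: emeasure_occ_measure[OF Q] emeasure_distr[OF meas Q]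
        emeasure_pmf_of_set[OF ne] ennreal_of_nat_eq_real_of_nat divide_ennreal)
qed (simp add: sets_occ_measure)

lemma occ_measure_in_borel_probs:
  assumes "T \<ge> 1" "\<And>t. z t \<in> X"
  shows "occ_measure X T z \<in> borel_probs X"
  unfolding occ_measure_eq_distr[OF assms] borel_probs_def
  using assms(2) by (auto intro!: measure_pmf.prob_space_distr simp: space_restrict_space)

lemma integral_occ_measure:
  fixes h :: "'a::topological_space \<Rightarrow> real"
  assumes "T \<ge> 1" "\<And>t. z t \<in> X" "continuous_on X h"
  shows "(\<integral>x. h x \<partial>occ_measure X T z) = (\<Sum>t<T. h (z t)) / real T"
proof -
  have "(\<integral>x. h x \<partial>occ_measure X T z) = (\<integral>t. h (z t) \<partial>measure_pmf (pmf_of_set {..<T}))"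
    unfolding occ_measure_eq_distr[OF assms(1,2)]
    by (rule integral_distr[OF _ borel_measurable_continuous_on_restrict[OF assms(3)]])
       (use assms(2) in \<open>auto simp: space_restrict_space\<close>)
  also have "\<dots> = (\<Sum>t<T. h (z t)) / real T"
    using \<open>T \<ge> 1\<close> by (subst integral_pmf_of_set) (auto simp: lessThan_empty_iff)
  finally show ?thesis .
qed

section \<open>Orthogonality and the square-root bound\<close>

text \<open>Independence makes the joint law a product, and Fubini's theorem integrates over
  \<open>Z\<close> first. This replaces a conditional expectation given \<open>X\<close>.\<close>

lemma (in prob_space) indep_var_integral_zero:
  fixes A :: "'b \<Rightarrow> real" and B :: "'b \<times> 'b \<Rightarrow> real"
  assumes ind: "indep_var N X N' Z"
    and A [measurable]: "A \<in> borel_measurable N" and a: "\<And>x. x \<in> space N \<Longrightarrow> \<bar>A x\<bar> \<le> a"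
    and B [measurable]: "B \<in> borel_measurable (N \<Otimes>\<^sub>M N')"
    and b: "\<And>x z. x \<in> space N \<Longrightarrow> z \<in> space N' \<Longrightarrow> \<bar>B (x, z)\<bar> \<le> b"
    and zero: "\<And>x. x \<in> space N \<Longrightarrow> (\<integral>z. B (x, z) \<partial>distr M N' Z) = 0"
  shows "expectation (\<lambda>\<omega>. A (X \<omega>) * B (X \<omega>, Z \<omega>)) = 0"
proof -
  have X [measurable]: "X \<in> measurable M N" and Z [measurable]: "Z \<in> measurable M N'"
    and law: "distr M N X \<Otimes>\<^sub>M distr M N' Z = distr M (N \<Otimes>\<^sub>M N') (\<lambda>\<omega>. (X \<omega>, Z \<omega>))"
    using ind unfolding indep_var_distribution_eq by auto
  interpret X: prob_space "distr M N X" by (rule prob_space_distr[OF X])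
  interpret Z: prob_space "distr M N' Z" by (rule prob_space_distr[OF Z])
  interpret P: pair_prob_space "distr M N X" "distr M N' Z" ..
  let ?h = "\<lambda>p. A (fst p) * B p"
  have meas: "?h \<in> borel_measurable (N \<Otimes>\<^sub>M N')" by simp
  have "integrable (distr M N X \<Otimes>\<^sub>M distr M N' Z) ?h"
  proof (rule P.integrable_const_bound[of _ "a * b"])
    show "AE p in distr M N X \<Otimes>\<^sub>M distr M N' Z. norm (?h p) \<le> a * b"
    proof (rule AE_I2)
      fix p assume "p \<in> space (distr M N X \<Otimes>\<^sub>M distr M N' Z)"
      then have p: "fst p \<in> space N" "snd p \<in> space N'" by (auto simp: space_pair_measure)
      then show "norm (?h p) \<le> a * b"
        using a[OF p(1)] b[OF p] by (simp add: abs_mult mult_mono)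
    qed
    show "?h \<in> borel_measurable (distr M N X \<Otimes>\<^sub>M distr M N' Z)"
      using meas by (simp cong: measurable_cong_sets)
  qed
  from P.integral_fst'[OF this]
  have "(\<integral>p. ?h p \<partial>(distr M N X \<Otimes>\<^sub>M distr M N' Z))
      = (\<integral>x. A x * (\<integral>z. B (x, z) \<partial>distr M N' Z) \<partial>distr M N X)" by simp
  also have "\<dots> = (\<integral>x. 0 \<partial>distr M N X)"
    by (rule Bochner_Integration.integral_cong) (simp_all add: zero)
  finally have "(\<integral>p. ?h p \<partial>distr M (N \<Otimes>\<^sub>M N') (\<lambda>\<omega>. (X \<omega>, Z \<omega>))) = 0" by (simp add: law)
  then show ?thesis by (subst (asm) integral_distr[OF _ meas]) simp_all
qed

text \<open>By orthogonality the cross terms vanish, so the second moment grows by at most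
  \<open>b\<^sup>2\<close> per step; passing from it to the first absolute moment gives the square
  root.\<close>

lemma (in prob_space) expectation_abs_sum_orthogonal_le:
  fixes D :: "nat \<Rightarrow> 'a \<Rightarrow> real"
  assumes meas [measurable]: "\<And>t. D t \<in> borel_measurable M"
    and b: "\<And>t \<omega>. \<omega> \<in> space M \<Longrightarrow> \<bar>D t \<omega>\<bar> \<le> b"
    and orth: "\<And>t. expectation (\<lambda>\<omega>. (\<Sum>i<t. D i \<omega>) * D t \<omega>) = 0"
    and "b > 0" "T \<ge> 1"
  shows "expectation (\<lambda>\<omega>. \<bar>\<Sum>t<T. D t \<omega>\<bar>) \<le> b * sqrt (real T)"
proof -
  have sum_b: "\<bar>\<Sum>i<t. D i \<omega>\<bar> \<le> real t * b" if "\<omega> \<in> space M" for t \<omega>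
    using sum_abs[of "\<lambda>i. D i \<omega>" "{..<t}"] sum_bounded_above[of "{..<t}" "\<lambda>i. \<bar>D i \<omega>\<bar>" b] b[OF that]
    by (intro order_trans[OF sum_abs]) simp
  have int: "integrable M (\<lambda>\<omega>. (\<Sum>i<t. D i \<omega>)\<^sup>2)" "integrable M (\<lambda>\<omega>. (\<Sum>i<t. D i \<omega>) * D t \<omega>)"
    "integrable M (\<lambda>\<omega>. (D t \<omega>)\<^sup>2)" for t
  proof -
    show "integrable M (\<lambda>\<omega>. (\<Sum>i<t. D i \<omega>)\<^sup>2)"
    proof (rule integrable_const_bound[of _ "(real t * b)\<^sup>2"], rule AE_I2)
      fix \<omega> assume "\<omega> \<in> space M"
      show "norm ((\<Sum>i<t. D i \<omega>)\<^sup>2) \<le> (real t * b)\<^sup>2"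
        using power_mono[OF sum_b[OF \<open>\<omega> \<in> space M\<close>], of t 2] by simp
    qed simp
    show "integrable M (\<lambda>\<omega>. (\<Sum>i<t. D i \<omega>) * D t \<omega>)"
    proof (rule integrable_const_bound[of _ "real t * b * b"], rule AE_I2)
      fix \<omega> assume "\<omega> \<in> space M"
      show "norm ((\<Sum>i<t. D i \<omega>) * D t \<omega>) \<le> real t * b * b"
        using mult_mono[OF sum_b[OF \<open>\<omega> \<in> space M\<close>, of t] b[OF \<open>\<omega> \<in> space M\<close>, of t]] \<open>b > 0\<close>
        by (simp add: abs_mult)
    qed simp
    show "integrable M (\<lambda>\<omega>. (D t \<omega>)\<^sup>2)"
    proof (rule integrable_const_bound[of _ "b\<^sup>2"], rule AE_I2)
      fix \<omega> assume "\<omega> \<in> space M"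
      show "norm ((D t \<omega>)\<^sup>2) \<le> b\<^sup>2"
        using power_mono[OF b[OF \<open>\<omega> \<in> space M\<close>], of t 2] by simp
    qed simp
  qed
  have sq: "expectation (\<lambda>\<omega>. (\<Sum>i<t. D i \<omega>)\<^sup>2) \<le> real t * b\<^sup>2" for t
  proof (induction t)
    case (Suc t)
    have "expectation (\<lambda>\<omega>. (\<Sum>i<Suc t. D i \<omega>)\<^sup>2)
        = expectation (\<lambda>\<omega>. (\<Sum>i<t. D i \<omega>)\<^sup>2 + 2 * ((\<Sum>i<t. D i \<omega>) * D t \<omega>) + (D t \<omega>)\<^sup>2)"
      by (simp add: power2_sum algebra_simps)
    also have "\<dots> = expectation (\<lambda>\<omega>. (\<Sum>i<t. D i \<omega>)\<^sup>2) + expectation (\<lambda>\<omega>. (D t \<omega>)\<^sup>2)"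
      using int[of t] orth[of t] by simp
    also have "expectation (\<lambda>\<omega>. (D t \<omega>)\<^sup>2) \<le> expectation (\<lambda>\<omega>. b\<^sup>2)"
      using b power_mono[of "\<bar>D t _\<bar>" b 2] by (intro integral_mono[OF int(3)]) auto
    finally show ?case using Suc by (simp add: prob_space algebra_simps)
  qed simp
  \<comment> \<open>\<open>a\<close> bounds the root mean square of the sum. With this weight each
    of the two terms in the arithmetic-geometric inequality below contributes at most
    \<open>a / 2\<close>.\<close>
  define a where "a = b * sqrt (real T)"
  have "a > 0" using \<open>b > 0\<close> \<open>T \<ge> 1\<close> by (simp add: a_def)
  have a2: "a\<^sup>2 = real T * b\<^sup>2" by (simp add: a_def power_mult_distrib)
  have amgm: "\<bar>x\<bar> \<le> (x\<^sup>2 / a + a) / 2" for x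
  proof -
    have "0 \<le> (\<bar>x\<bar> - a)\<^sup>2" by simp
    then have "2 * \<bar>x\<bar> * a \<le> x\<^sup>2 + a\<^sup>2" by (simp add: power2_diff)
    then show ?thesis using \<open>a > 0\<close> by (simp add: field_simps power2_eq_square)
  qed
  have "expectation (\<lambda>\<omega>. \<bar>\<Sum>t<T. D t \<omega>\<bar>) \<le> expectation (\<lambda>\<omega>. ((\<Sum>t<T. D t \<omega>)\<^sup>2 / a + a) / 2)"
    using int(1)[of T] \<open>a > 0\<close> amgm by (intro integral_mono') auto
  also have "\<dots> = (expectation (\<lambda>\<omega>. (\<Sum>t<T. D t \<omega>)\<^sup>2) / a + a) / 2"
    using int(1)[of T] by (simp add: prob_space)
  also have "\<dots> \<le> (a\<^sup>2 / a + a) / 2"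
    using sq[of T] \<open>a > 0\<close> unfolding a2 by (simp add: divide_right_mono)
  also have "\<dots> = a" using \<open>a > 0\<close> by (simp add: power2_eq_square)
  finally show ?thesis by (simp add: a_def)
qed

subsection \<open>Controlled trajectories\<close>

lemma control_cong:
  assumes "\<And>i. i < t \<Longrightarrow> s i = s' i"
  shows "control \<pi> s t = control \<pi> s' t"
  unfolding control_def using assms by (metis lessThan_iff restrict_ext)

text \<open>Nonanticipation: the noise path may be replaced by its restriction to the times before
  \<open>t\<close>, so that trajectories become functions on finite product spaces.\<close>

lemma state_cong:
  assumes "\<And>i. i < t \<Longrightarrow> s i = s' i"
  shows "state f \<pi> y0 s t = state f \<pi> y0 s' t"
  using assms
proof (induction t)
  case (Suc t)
  then have "state f \<pi> y0 s t = state f \<pi> y0 s' t" "control \<pi> s t = control \<pi> s' t" "s t = s' t"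
    by (auto intro!: control_cong)
  then show ?case by simp
qed simp

text \<open>Adding \<open>\<phi> (y t) - \<phi> (y (Suc t))\<close> turns the drift into a martingale difference.\<close>

definition increment ::
    "('y \<times> 'u \<times> 's \<Rightarrow> 'y) \<Rightarrow> 's measure \<Rightarrow> ('y \<Rightarrow> real) \<Rightarrow> (nat \<Rightarrow> (nat \<Rightarrow> 's) \<Rightarrow> 'u) \<Rightarrow> 'y \<Rightarrow> (nat \<Rightarrow> 's) \<Rightarrow> nat \<Rightarrow> real" where
  "increment f \<mu> \<phi> \<pi> y0 s t =
     drift f \<mu> \<phi> (state f \<pi> y0 s t, control \<pi> s t) + \<phi> (state f \<pi> y0 s t) - \<phi> (state f \<pi> y0 s (Suc t))"

lemma increment_cong:
  assumes "\<And>i. i < Suc t \<Longrightarrow> s i = s' i"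
  shows "increment f \<mu> \<phi> \<pi> y0 s t = increment f \<mu> \<phi> \<pi> y0 s' t"
proof -
  have "control \<pi> s t = control \<pi> s' t" by (rule control_cong) (use assms in auto)
  moreover have "state f \<pi> y0 s t = state f \<pi> y0 s' t" by (rule state_cong) (use assms in auto)
  moreover have "state f \<pi> y0 s (Suc t) = state f \<pi> y0 s' (Suc t)" by (rule state_cong) (use assms in auto)
  ultimately show ?thesis by (simp only: increment_def)
qed

text \<open>The terms in the current state cancel, leaving the average over a fresh noise value
  minus the realized value; in this form the conditional mean is visibly zero.\<close>

lemma increment_eq:
  "increment f \<mu> \<phi> \<pi> y0 s t =
     (\<integral>v. \<phi> (f (state f \<pi> y0 s t, control \<pi> s t, v)) \<partial>\<mu>) - \<phi> (f (state f \<pi> y0 s t, control \<pi> s t, s t))"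
  by (simp add: increment_def drift_def)

text \<open>The added terms telescope. Only the two end values remain, at a cost independent of
  \<open>T\<close> when \<open>\<phi>\<close> is bounded on \<open>Y\<close>.\<close>

lemma sum_increment:
  "(\<Sum>t<T. increment f \<mu> \<phi> \<pi> y0 s t) =
     (\<Sum>t<T. drift f \<mu> \<phi> (state f \<pi> y0 s t, control \<pi> s t)) + \<phi> y0 - \<phi> (state f \<pi> y0 s T)"
  by (induction T) (simp_all add: increment_def)

section \<open>Measurability and martingale differences of the controlled system\<close>

locale controlled_system = prob_space M
  for M :: "'w measure" +
  fixes Y :: "'y::metric_space set" and U :: "'u::metric_space set" and S :: "'s::metric_space set"
    and f :: "'y \<times> 'u \<times> 's \<Rightarrow> 'y" and \<sigma> :: "nat \<Rightarrow> 'w \<Rightarrow> 's"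
  assumes compact_Y: "compact Y" and compact_U: "compact U" and compact_S: "compact S"
    and continuous_f: "continuous_on (Y \<times> U \<times> S) f" and f_image: "f ` (Y \<times> U \<times> S) \<subseteq> Y"
    and indep: "indep_vars (\<lambda>_. restrict_space borel S) \<sigma> UNIV"
    and ident: "\<And>t. distr M (restrict_space borel S) (\<sigma> t) = distr M (restrict_space borel S) (\<sigma> 0)"
begin

definition "\<mu> = distr M (restrict_space borel S) (\<sigma> 0)"

abbreviation "noise n \<equiv> PiM {..<n} (\<lambda>_. restrict_space borel S)"

lemma \<sigma>_measurable [measurable]: "\<sigma> t \<in> measurable M (restrict_space borel S)"
  using indep by (auto simp: indep_vars_def)

lemma \<mu>_borel_probs: "\<mu> \<in> borel_probs S"
  unfolding borel_probs_def \<mu>_def using prob_space_distr[OF \<sigma>_measurable[of 0]] by simp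

lemma \<sigma>_in_S: "\<omega> \<in> space M \<Longrightarrow> \<sigma> t \<omega> \<in> S"
  using measurable_space[OF \<sigma>_measurable[of t]] by (simp add: space_restrict_space)

lemma control_measurable:
  assumes "\<pi> \<in> control_plans U S" "t \<le> n"
  shows "(\<lambda>s. control \<pi> s t) \<in> measurable (noise n) (restrict_space borel U)"
  unfolding control_def
  by (rule measurable_compose[OF measurable_restrict_subset])
     (use assms in \<open>auto simp: control_plans_def\<close>)

text \<open>Continuity gives measurability for the Borel sets of the triple product; two
  applications of \<open>measurable_Pair_compact\<close> connect this with measurable
  components.\<close>

lemma f_measurable:
  assumes "a \<in> measurable N (restrict_space borel Y)" "b \<in> measurable N (restrict_space borel U)"
    and "c \<in> measurable N (restrict_space borel S)"
  shows "(\<lambda>x. f (a x, b x, c x)) \<in> measurable N (restrict_space borel Y)"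
proof -
  have "f \<in> measurable (restrict_space borel (Y \<times> U \<times> S)) (restrict_space borel Y)"
    using f_image borel_measurable_continuous_on_restrict[OF continuous_f]
    by (intro measurable_restrict_space2) (auto simp: space_restrict_space)
  from measurable_compose[OF measurable_Pair_compact[OF compact_Y compact_Times[OF compact_U compact_S]
      assms(1) measurable_Pair_compact[OF compact_U compact_S assms(2,3)]] this]
  show ?thesis .
qed

lemma state_measurable:
  assumes "\<pi> \<in> control_plans U S" "y0 \<in> Y" "t \<le> n"
  shows "(\<lambda>s. state f \<pi> y0 s t) \<in> measurable (noise n) (restrict_space borel Y)"
  using \<open>t \<le> n\<close>
proof (induction t)
  case 0
  then show ?case using \<open>y0 \<in> Y\<close> by (simp add: space_restrict_space)
next
  case (Suc t)
  have "(\<lambda>s. s t) \<in> measurable (noise n) (restrict_space borel S)"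
    using Suc.prems by (intro measurable_component_singleton) auto
  then show ?case
    using f_measurable[OF Suc.IH control_measurable[OF assms(1)]] Suc.prems by simp
qed

text \<open>Invariance is read off from the target spaces of measurable maps. The noise is first
  truncated, as elements of the space of \<open>noise t\<close> are undefined from \<open>t\<close>
  on.\<close>

lemma state_control_in:
  assumes "\<pi> \<in> control_plans U S" "y0 \<in> Y" "\<And>i. s i \<in> S"
  shows "state f \<pi> y0 s t \<in> Y" "control \<pi> s t \<in> U"
proof -
  have s: "restrict s {..<t} \<in> space (noise t)"
    using assms(3) by (auto simp: space_PiM space_restrict_space)
  have "state f \<pi> y0 (restrict s {..<t}) t \<in> Y"
    using measurable_space[OF state_measurable[OF assms(1,2) order_refl] s] by (simp add: space_restrict_space)
  then show "state f \<pi> y0 s t \<in> Y"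
    by (subst state_cong[of t s "restrict s {..<t}"]) auto
  have "control \<pi> (restrict s {..<t}) t \<in> U"
    using measurable_space[OF control_measurable[OF assms(1) order_refl] s] by (simp add: space_restrict_space)
  then show "control \<pi> s t \<in> U"
    by (subst control_cong[of t s "restrict s {..<t}"]) auto
qed

context
  fixes \<phi> :: "'y \<Rightarrow> real" and \<pi> y0
  assumes \<phi>: "continuous_on Y \<phi>" and \<phi>_le: "\<And>y. y \<in> Y \<Longrightarrow> \<bar>\<phi> y\<bar> \<le> 1"
    and \<pi>: "\<pi> \<in> control_plans U S" and y0: "y0 \<in> Y"
begin

lemma drift_measurable:
  assumes "a \<in> measurable N (restrict_space borel Y)" "b \<in> measurable N (restrict_space borel U)"
  shows "(\<lambda>x. drift f \<mu> \<phi> (a x, b x)) \<in> borel_measurable N"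
  by (rule measurable_compose[OF measurable_Pair_compact[OF compact_Y compact_U assms]
        borel_measurable_continuous_on_restrict[OF continuous_on_drift[OF compact_Y continuous_f f_image \<mu>_borel_probs \<phi>]]])

lemma \<phi>_measurable:
  assumes "a \<in> measurable N (restrict_space borel Y)"
  shows "(\<lambda>x. \<phi> (a x)) \<in> borel_measurable N"
  by (rule measurable_compose[OF assms borel_measurable_continuous_on_restrict[OF \<phi>]])

lemma increment_measurable:
  assumes "t < n"
  shows "(\<lambda>s. increment f \<mu> \<phi> \<pi> y0 s t) \<in> borel_measurable (noise n)"
proof -
  have st: "(\<lambda>s. state f \<pi> y0 s k) \<in> measurable (noise n) (restrict_space borel Y)" if "k \<le> n" for k
    using state_measurable[OF \<pi> y0 that] .
  have ct: "(\<lambda>s. control \<pi> s t) \<in> measurable (noise n) (restrict_space borel U)"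
    using control_measurable[OF \<pi>, of t n] assms by simp
  show ?thesis unfolding increment_def
    by (intro borel_measurable_diff borel_measurable_add drift_measurable \<phi>_measurable st ct)
       (use assms in auto)
qed

lemma integral_\<phi>_le:
  assumes "y \<in> Y" "u \<in> U"
  shows "\<bar>\<integral>v. \<phi> (f (y, u, v)) \<partial>\<mu>\<bar> \<le> 1"
proof -
  interpret \<mu>: prob_space \<mu> using borel_probsD(1)[OF \<mu>_borel_probs] .
  show ?thesis
    using borel_probsD(3)[OF \<mu>_borel_probs] f_image assms
    by (intro \<mu>.abs_integral_le_const \<phi>_le) (auto simp: image_subset_iff)
qed

lemma increment_le:
  assumes "\<And>i. s i \<in> S"
  shows "\<bar>increment f \<mu> \<phi> \<pi> y0 s t\<bar> \<le> 2"
proof -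
  have in_: "state f \<pi> y0 s t \<in> Y" "control \<pi> s t \<in> U"
    using state_control_in[OF \<pi> y0, of s] assms by auto
  have "\<bar>\<phi> (f (state f \<pi> y0 s t, control \<pi> s t, s t))\<bar> \<le> 1"
    using f_image in_ assms by (intro \<phi>_le) (auto simp: image_subset_iff)
  with integral_\<phi>_le[OF in_] show ?thesis unfolding increment_eq by linarith
qed

lemma restrict_noise_measurable: "(\<lambda>\<omega>. restrict (\<lambda>i. \<sigma> i \<omega>) {..<n}) \<in> measurable M (noise n)"
  by (intro measurable_restrict) simp

lemma increment_noise_measurable:
  "(\<lambda>\<omega>. increment f \<mu> \<phi> \<pi> y0 (\<lambda>i. \<sigma> i \<omega>) t) \<in> borel_measurable M"
proof -
  have "increment f \<mu> \<phi> \<pi> y0 (\<lambda>i. \<sigma> i \<omega>) t = increment f \<mu> \<phi> \<pi> y0 (restrict (\<lambda>i. \<sigma> i \<omega>) {..<Suc t}) t" for \<omega>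
    by (rule increment_cong) simp
  then show ?thesis
    using measurable_compose[OF restrict_noise_measurable increment_measurable[OF lessI]] by simp
qed

text \<open>The earlier increments are a function \<open>A\<close> of the noise before
  \<open>t\<close>, the current one a function \<open>B\<close> of that noise and of
  \<open>\<sigma> t\<close>. For a fixed past, \<open>B\<close> is the mean of a variable minus that
  variable, so it integrates to zero.\<close>

lemma increment_orthogonal:
  "expectation (\<lambda>\<omega>. (\<Sum>i<t. increment f \<mu> \<phi> \<pi> y0 (\<lambda>i. \<sigma> i \<omega>) i) * increment f \<mu> \<phi> \<pi> y0 (\<lambda>i. \<sigma> i \<omega>) t) = 0"
proof -
  interpret \<mu>: prob_space \<mu> using borel_probsD(1)[OF \<mu>_borel_probs] .
  have sp: "space \<mu> = S" by (rule borel_probsD(3)[OF \<mu>_borel_probs])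
  \<comment> \<open>\<open>indep_var\<close> relates variables of the same type, so the single value
    \<open>\<sigma> t\<close> is carried as a function on \<open>{t}\<close>.\<close>
  let ?N = "noise t" and ?N' = "PiM {t} (\<lambda>_. restrict_space borel S)"
  let ?X = "\<lambda>\<omega>. restrict (\<lambda>i. \<sigma> i \<omega>) {..<t}" and ?Z = "\<lambda>\<omega>. restrict (\<lambda>i. \<sigma> i \<omega>) {t}"
  define I where "I x = (\<integral>v. \<phi> (f (state f \<pi> y0 x t, control \<pi> x t, v)) \<partial>\<mu>)" for x
  define A where "A x = (\<Sum>i<t. increment f \<mu> \<phi> \<pi> y0 x i)" for x
  define B where "B p = I (fst p) - \<phi> (f (state f \<pi> y0 (fst p) t, control \<pi> (fst p) t, snd p t))" for p
  have in_: "state f \<pi> y0 x t \<in> Y" "control \<pi> x t \<in> U" if "x \<in> space ?N" for x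
    using measurable_space[OF state_measurable[OF \<pi> y0 order_refl] that]
      measurable_space[OF control_measurable[OF \<pi> order_refl] that] by (simp_all add: space_restrict_space)
  have ind: "indep_var ?N ?X ?N' ?Z"
    by (rule indep_var_restrict[OF indep]) auto
  have "expectation (\<lambda>\<omega>. A (?X \<omega>) * B (?X \<omega>, ?Z \<omega>)) = 0"
  proof (rule indep_var_integral_zero[OF ind])
    show "A \<in> borel_measurable ?N"
      unfolding A_def by (intro borel_measurable_sum increment_measurable) simp
    fix x assume x: "x \<in> space ?N"
    show "\<bar>A x\<bar> \<le> real t * 2"
    proof -
      obtain s0 where "s0 \<in> S" using \<mu>.not_empty sp by auto
      \<comment> \<open>\<open>x\<close> is undefined from time \<open>t\<close> on, hence possibly outside \<open>S\<close>\<close>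
      define x' where "x' i = (if i < t then x i else s0)" for i
      have "x' i \<in> S" for i
        using x \<open>s0 \<in> S\<close> by (auto simp: x'_def space_PiM space_restrict_space)
      then have "\<bar>increment f \<mu> \<phi> \<pi> y0 x' i\<bar> \<le> 2" for i by (rule increment_le)
      moreover have "increment f \<mu> \<phi> \<pi> y0 x i = increment f \<mu> \<phi> \<pi> y0 x' i" if "i < t" for i
        using that by (intro increment_cong) (auto simp: x'_def)
      ultimately have "(\<Sum>i<t. \<bar>increment f \<mu> \<phi> \<pi> y0 x i\<bar>) \<le> (\<Sum>i<t. 2)"
        by (intro sum_mono) simp
      then show ?thesis unfolding A_def by (intro order_trans[OF sum_abs]) simp
    qed
    show "\<bar>B (x, z)\<bar> \<le> 2" if z: "z \<in> space ?N'" for z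
    proof -
      have "z t \<in> S" using z by (auto simp: space_PiM space_restrict_space)
      then have "\<bar>\<phi> (f (state f \<pi> y0 x t, control \<pi> x t, z t))\<bar> \<le> 1"
        using f_image in_[OF x] by (intro \<phi>_le) (auto simp: image_subset_iff)
      with integral_\<phi>_le[OF in_[OF x]] show ?thesis by (simp add: B_def I_def)
    qed
    show "(\<integral>z. B (x, z) \<partial>distr M ?N' ?Z) = 0"
    proof -
      let ?h = "\<lambda>v. I x - \<phi> (f (state f \<pi> y0 x t, control \<pi> x t, v))"
      have int: "integrable \<mu> (\<lambda>v. \<phi> (f (state f \<pi> y0 x t, control \<pi> x t, v)))"
        by (rule integrable_one_step[OF f_image continuous_f \<mu>_borel_probs compact_S \<phi> in_[OF x]])
      have h: "?h \<in> borel_measurable (restrict_space borel S)"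
        using borel_measurable_integrable[OF int] by (simp add: \<mu>_def)
      have Z: "?Z \<in> measurable M ?N'" by (intro measurable_restrict) simp
      have comp: "(\<lambda>z. z t) \<in> measurable ?N' (restrict_space borel S)"
        by (rule measurable_component_singleton) simp
      have "(\<integral>z. B (x, z) \<partial>distr M ?N' ?Z) = (\<integral>\<omega>. ?h (\<sigma> t \<omega>) \<partial>M)"
        unfolding B_def using measurable_compose[OF comp h]
        by (subst integral_distr[OF Z]) simp_all
      \<comment> \<open>Identical distribution enters here: the law of \<open>\<sigma> t\<close> is
        \<open>\<mu>\<close>, under which the subtracted term has mean \<open>I x\<close>.\<close>
      also have "\<dots> = (\<integral>v. ?h v \<partial>\<mu>)"
        unfolding \<mu>_def ident[of t, symmetric] by (rule integral_distr[OF \<sigma>_measurable h, symmetric])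
      also have "\<dots> = 0" using int by (simp add: I_def \<mu>.prob_space)
      finally show ?thesis .
    qed
  next
    have st: "(\<lambda>p. state f \<pi> y0 (fst p) t) \<in> measurable (?N \<Otimes>\<^sub>M ?N') (restrict_space borel Y)"
      by (rule measurable_compose[OF measurable_fst state_measurable[OF \<pi> y0 order_refl]])
    have ct: "(\<lambda>p. control \<pi> (fst p) t) \<in> measurable (?N \<Otimes>\<^sub>M ?N') (restrict_space borel U)"
      by (rule measurable_compose[OF measurable_fst control_measurable[OF \<pi> order_refl]])
    have zt: "(\<lambda>p. snd p t) \<in> measurable (?N \<Otimes>\<^sub>M ?N') (restrict_space borel S)"
      by (rule measurable_compose[OF measurable_snd measurable_component_singleton]) simp
    \<comment> \<open>Writing the parameter integral as a drift plus a state term reduces its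
      measurability to the continuity of the drift.\<close>
    have "I x = drift f \<mu> \<phi> (state f \<pi> y0 x t, control \<pi> x t) + \<phi> (state f \<pi> y0 x t)" for x
      by (simp add: I_def drift_def)
    then show "B \<in> borel_measurable (?N \<Otimes>\<^sub>M ?N')"
      unfolding B_def
      by (simp only:)
         (intro borel_measurable_diff borel_measurable_add drift_measurable \<phi>_measurable f_measurable st ct zt)
  qed
  moreover have "A (?X \<omega>) * B (?X \<omega>, ?Z \<omega>) =
      (\<Sum>i<t. increment f \<mu> \<phi> \<pi> y0 (\<lambda>i. \<sigma> i \<omega>) i) * increment f \<mu> \<phi> \<pi> y0 (\<lambda>i. \<sigma> i \<omega>) t" for \<omega>
  proof -
    have "A (?X \<omega>) = (\<Sum>i<t. increment f \<mu> \<phi> \<pi> y0 (\<lambda>i. \<sigma> i \<omega>) i)"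
      unfolding A_def by (intro sum.cong increment_cong) auto
    moreover have "state f \<pi> y0 (?X \<omega>) t = state f \<pi> y0 (\<lambda>i. \<sigma> i \<omega>) t"
      by (rule state_cong) simp
    moreover have "control \<pi> (?X \<omega>) t = control \<pi> (\<lambda>i. \<sigma> i \<omega>) t"
      by (rule control_cong) simp
    ultimately show ?thesis by (simp add: B_def I_def increment_eq)
  qed
  ultimately show ?thesis by simp
qed

text \<open>\<open>T\<close> times the integral is the sum of the increments up to a boundary term
  of size at most 2. Increments are bounded by 2, so the first absolute moment is at most
  \<open>2 * sqrt T + 2\<close>, and \<open>T \<ge> 1\<close> absorbs the constant.\<close>

lemma expectation_abs_drift_le:
  fixes T :: nat
  assumes "T \<ge> 1"
  defines "\<And>\<omega>. g \<omega> \<equiv> \<bar>\<integral>x. drift f \<mu> \<phi> x \<partial>random_occ_measure Y U f \<sigma> \<pi> y0 T \<omega>\<bar>"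
  shows "integrable M g" "expectation g \<le> 4 / sqrt (real T)"
proof -
  let ?D = "\<lambda>t \<omega>. increment f \<mu> \<phi> \<pi> y0 (\<lambda>i. \<sigma> i \<omega>) t"
  let ?y = "\<lambda>t \<omega>. state f \<pi> y0 (\<lambda>i. \<sigma> i \<omega>) t"
  \<comment> \<open>On the sample space \<open>h\<close> equals \<open>g\<close>, but it involves
    only finitely many increments and the final state, so it is measurable without any treatment of
    measure-valued maps.\<close>
  define h where "h \<omega> = \<bar>((\<Sum>t<T. ?D t \<omega>) - \<phi> y0 + \<phi> (?y T \<omega>)) / real T\<bar>" for \<omega>
  have in_: "?y t \<omega> \<in> Y" "control \<pi> (\<lambda>i. \<sigma> i \<omega>) t \<in> U" if "\<omega> \<in> space M" for t \<omega>
    using state_control_in[OF \<pi> y0] \<sigma>_in_S[OF that] by auto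
  have gh: "g \<omega> = h \<omega>" if "\<omega> \<in> space M" for \<omega>
    unfolding g_def h_def random_occ_measure_def sum_increment using in_[OF that]
    by (subst integral_occ_measure[OF \<open>T \<ge> 1\<close> _
          continuous_on_drift[OF compact_Y continuous_f f_image \<mu>_borel_probs \<phi>]]) auto
  have D: "?D t \<in> borel_measurable M" for t by (rule increment_noise_measurable)
  have D2: "\<bar>?D t \<omega>\<bar> \<le> 2" if "\<omega> \<in> space M" for t \<omega> by (rule increment_le[OF \<sigma>_in_S[OF that]])
  have intD: "integrable M (\<lambda>\<omega>. \<bar>\<Sum>t<T. ?D t \<omega>\<bar>)"
    using D D2 by (intro integrable_abs Bochner_Integration.integrable_sum integrable_const_bound[of _ 2]) auto
  have y_meas: "(\<lambda>\<omega>. \<phi> (?y T \<omega>)) \<in> borel_measurable M"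
  proof -
    have "?y T \<omega> = state f \<pi> y0 (restrict (\<lambda>i. \<sigma> i \<omega>) {..<T}) T" for \<omega>
      by (rule state_cong) simp
    then show ?thesis
      using \<phi>_measurable[OF measurable_compose[OF restrict_noise_measurable state_measurable[OF \<pi> y0 order_refl]]]
      by simp
  qed
  have h_meas: "h \<in> borel_measurable M"
    unfolding h_def using D y_meas by measurable
  have h_le: "h \<omega> \<le> (\<bar>\<Sum>t<T. ?D t \<omega>\<bar> + 2) / real T" if "\<omega> \<in> space M" for \<omega>
    unfolding h_def abs_divide
    using \<phi>_le[OF y0] \<phi>_le[OF in_(1)[OF that, of T]] by (auto intro!: divide_right_mono)
  have "integrable M h"
  proof (rule Bochner_Integration.integrable_bound[OF _ h_meas])
    show "integrable M (\<lambda>\<omega>. (\<bar>\<Sum>t<T. ?D t \<omega>\<bar> + 2) / real T)" using intD by simp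
    show "AE \<omega> in M. norm (h \<omega>) \<le> norm ((\<bar>\<Sum>t<T. ?D t \<omega>\<bar> + 2) / real T)"
    proof (rule AE_I2)
      fix \<omega> assume "\<omega> \<in> space M"
      from h_le[OF this] show "norm (h \<omega>) \<le> norm ((\<bar>\<Sum>t<T. ?D t \<omega>\<bar> + 2) / real T)"
        by (simp add: h_def)
    qed
  qed
  then show "integrable M g" using gh by (simp cong: Bochner_Integration.integrable_cong)
  have "expectation g = expectation h" using gh by (rule Bochner_Integration.integral_cong[OF refl])
  also have "\<dots> \<le> expectation (\<lambda>\<omega>. (\<bar>\<Sum>t<T. ?D t \<omega>\<bar> + 2) / real T)"
    using intD h_le \<open>integrable M h\<close> by (intro integral_mono) auto
  also have "\<dots> = (expectation (\<lambda>\<omega>. \<bar>\<Sum>t<T. ?D t \<omega>\<bar>) + 2) / real T"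
    using intD by (simp add: prob_space)
  also have "\<dots> \<le> (2 * sqrt (real T) + 2) / real T"
    using expectation_abs_sum_orthogonal_le[of ?D 2 T, OF D D2 increment_orthogonal] \<open>T \<ge> 1\<close>
    by (intro divide_right_mono) auto
  also have "\<dots> \<le> (4 * sqrt (real T)) / real T"
    using \<open>T \<ge> 1\<close> by (intro divide_right_mono) auto
  also have "\<dots> = 4 / sqrt (real T)"
    using \<open>T \<ge> 1\<close> by (simp add: real_div_sqrt field_simps)
  finally show "expectation g \<le> 4 / sqrt (real T)" .
qed

end

end

section \<open>Expected distance to the stationary measures\<close>

context controlled_system
begin

context
  fixes q :: "nat \<Rightarrow> 'y \<times> 'u \<Rightarrow> real" and u0 :: 'u
  assumes q: "dense_lipschitz_seq (Y \<times> U) q" and u0: "u0 \<in> U"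
begin

abbreviation "W \<equiv> stationary_measures Y U f \<mu>"

abbreviation "test k \<equiv> \<lambda>y. q (Suc k) (y, u0)"

lemma W_subset: "W \<subseteq> borel_probs (Y \<times> U)"
  by (auto simp: stationary_measures_def)

lemma continuous_test: "continuous_on Y (test k)"
  by (rule continuous_on_compose2[OF dense_lipschitz_seqD(1)[OF q]])
     (use u0 in \<open>auto intro!: continuous_intros\<close>)

lemma test_le: "y \<in> Y \<Longrightarrow> \<bar>test k y\<bar> \<le> 1"
  using dense_lipschitz_seqD(2)[OF q] u0 by simp

text \<open>A measure far from \<open>W\<close> fails one of the \<open>N\<close> tests, so one
  integral reaches \<open>1 / Suc N\<close> in absolute value. Bounding it by the sum gives an
  inequality that can be integrated, in the manner of Markov's inequality.\<close>

lemma near_W: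
  assumes "\<epsilon> > 0"
  obtains N where "\<And>\<gamma>. \<gamma> \<in> borel_probs (Y \<times> U) \<Longrightarrow>
      (\<And>\<gamma>'. \<gamma>' \<in> W \<Longrightarrow> \<epsilon> \<le> rho q \<gamma> \<gamma>') \<Longrightarrow>
      1 \<le> real (Suc N) * (\<Sum>k<N. \<bar>\<integral>x. drift f \<mu> (test k) x \<partial>\<gamma>\<bar>)"
proof -
  from near_stationary[OF compact_Y compact_U compact_S continuous_f f_image \<mu>_borel_probs q u0 assms]
  obtain N where N: "\<forall>\<gamma>\<in>borel_probs (Y \<times> U).
      (\<forall>k<N. \<bar>\<integral>x. drift f \<mu> (test k) x \<partial>\<gamma>\<bar> < 1 / real (Suc N)) \<longrightarrow> (\<exists>\<gamma>'\<in>W. rho q \<gamma> \<gamma>' < \<epsilon>)" ..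
  show thesis
  proof (rule that)
    fix \<gamma> assume \<gamma>: "\<gamma> \<in> borel_probs (Y \<times> U)" and far: "\<And>\<gamma>'. \<gamma>' \<in> W \<Longrightarrow> \<epsilon> \<le> rho q \<gamma> \<gamma>'"
    let ?g = "\<lambda>k. \<bar>\<integral>x. drift f \<mu> (test k) x \<partial>\<gamma>\<bar>"
    from N \<gamma> far obtain k where k: "k < N" "1 / real (Suc N) \<le> ?g k"
      by (meson linorder_not_less)
    have "?g k \<le> (\<Sum>k<N. ?g k)" using k(1) by (intro member_le_sum) auto
    with k(2) have "1 / real (Suc N) \<le> (\<Sum>k<N. ?g k)" by linarith
    then show "1 \<le> real (Suc N) * (\<Sum>k<N. ?g k)" by (simp add: pos_divide_le_eq mult.commute)
  qed
qed

context
  fixes \<pi> y0 T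
  assumes \<pi>: "\<pi> \<in> control_plans U S" and y0: "y0 \<in> Y" and T: "T \<ge> (1::nat)"
begin

lemma random_occ_measure_in_borel_probs:
  "\<omega> \<in> space M \<Longrightarrow> random_occ_measure Y U f \<sigma> \<pi> y0 T \<omega> \<in> borel_probs (Y \<times> U)"
  unfolding random_occ_measure_def
  by (rule occ_measure_in_borel_probs[OF T]) (use state_control_in[OF \<pi> y0] \<sigma>_in_S in auto)

lemma expectation_sum_drift_le:
  defines "\<And>\<omega>. h N \<omega> \<equiv> \<Sum>k<N. \<bar>\<integral>x. drift f \<mu> (test k) x \<partial>random_occ_measure Y U f \<sigma> \<pi> y0 T \<omega>\<bar>"
  shows "integrable M (h N)" "expectation (h N) \<le> real N * (4 / sqrt (real T))"
proof -
  note g = expectation_abs_drift_le[OF continuous_test test_le \<pi> y0 T]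
  show "integrable M (h N)" unfolding h_def by (intro Bochner_Integration.integrable_sum g)
  have "expectation (h N) = (\<Sum>k<N. expectation (\<lambda>\<omega>. \<bar>\<integral>x. drift f \<mu> (test k) x \<partial>random_occ_measure Y U f \<sigma> \<pi> y0 T \<omega>\<bar>))"
    unfolding h_def by (intro Bochner_Integration.integral_sum g)
  also have "\<dots> \<le> (\<Sum>k<N. 4 / sqrt (real T))" by (intro sum_mono g)
  finally show "expectation (h N) \<le> real N * (4 / sqrt (real T))" by simp
qed

end

text \<open>Without stationary measures every measure is vacuously far, which bounds the sum of test
  integrals below on the whole sample space. Under the constant plan \<open>u0\<close> its
  expectation is too small for a long horizon. Nonemptiness is what gives the infimum in
  \<open>rho_set\<close> an upper bound.\<close>

lemma W_nonempty:
  assumes "y0 \<in> Y"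
  shows "W \<noteq> {}"
proof
  assume "W = {}"
  obtain N where N: "\<And>\<gamma>. \<gamma> \<in> borel_probs (Y \<times> U) \<Longrightarrow> (\<And>\<gamma>'. \<gamma>' \<in> W \<Longrightarrow> 1 \<le> rho q \<gamma> \<gamma>') \<Longrightarrow>
      1 \<le> real (Suc N) * (\<Sum>k<N. \<bar>\<integral>x. drift f \<mu> (test k) x \<partial>\<gamma>\<bar>)"
    using near_W[of 1] by auto
  define \<pi> :: "nat \<Rightarrow> (nat \<Rightarrow> 's) \<Rightarrow> 'u" where "\<pi> = (\<lambda>_ _. u0)"
  have \<pi>: "\<pi> \<in> control_plans U S" using u0 by (simp add: \<pi>_def control_plans_def space_restrict_space)
  \<comment> \<open>\<open>T\<close> will be a square, with root \<open>n\<close>; this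
    \<open>n\<close> makes the final bound \<open>(n - 1) / n\<close>, just below 1.\<close>
  define n where "n = 4 * (Suc N * N) + 1"
  define T where "T = n\<^sup>2"
  have "n > 0" by (simp add: n_def)
  then have "T \<ge> 1" by (simp add: T_def Suc_le_eq)
  let ?h = "\<lambda>\<omega>. \<Sum>k<N. \<bar>\<integral>x. drift f \<mu> (test k) x \<partial>random_occ_measure Y U f \<sigma> \<pi> y0 T \<omega>\<bar>"
  note h = expectation_sum_drift_le[OF \<pi> assms \<open>T \<ge> 1\<close>, of N]
  have "expectation (\<lambda>_. 1) \<le> expectation (\<lambda>\<omega>. real (Suc N) * ?h \<omega>)"
  proof (rule integral_mono)
    show "integrable M (\<lambda>\<omega>. real (Suc N) * ?h \<omega>)" using h(1) by (rule integrable_mult_right)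
    fix \<omega> assume "\<omega> \<in> space M"
    from random_occ_measure_in_borel_probs[OF \<pi> assms \<open>T \<ge> 1\<close> this]
    show "1 \<le> real (Suc N) * ?h \<omega>" by (rule N) (simp add: \<open>W = {}\<close>)
  qed simp
  also have "\<dots> = real (Suc N) * expectation ?h" by (rule integral_mult_right_zero)
  also have "\<dots> \<le> real (Suc N) * (real N * (4 / sqrt (real T)))"
    by (intro mult_left_mono h(2)) simp
  also have "\<dots> = (real n - 1) / real n"
    by (simp add: T_def n_def algebra_simps add_divide_distrib)
  also have "\<dots> < 1" using \<open>n > 0\<close> by (simp add: divide_less_eq_1_pos)
  finally show False by (simp add: prob_space)
qed

lemma rho_set_le_2:
  assumes "y0 \<in> Y" "\<gamma> \<in> borel_probs (Y \<times> U)"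
  shows "rho_set q \<gamma> W \<le> 2"
proof -
  obtain \<gamma>' where "\<gamma>' \<in> W" using W_nonempty[OF assms(1)] by blast
  then show ?thesis
    using rho_set_le_rho[OF q assms(2) W_subset] rho_le_2[OF q assms(2)] W_subset
    by (meson order_trans subsetD)
qed

text \<open>Pointwise, the distance is at most \<open>\<epsilon>\<close> for measures near
  \<open>W\<close>, and otherwise at most 2, hence at most \<open>2 * Suc N * ?h\<close>. The
  constant \<open>c\<close> is fixed before the plan, the initial state and
  \<open>T\<close>.\<close>

lemma expectation_rho_set_le:
  assumes "\<epsilon> > 0"
  obtains c where "\<And>\<pi> y0 T. \<pi> \<in> control_plans U S \<Longrightarrow> y0 \<in> Y \<Longrightarrow> T \<ge> 1 \<Longrightarrow>
    expectation (\<lambda>\<omega>. rho_set q (random_occ_measure Y U f \<sigma> \<pi> y0 T \<omega>) W) \<le> \<epsilon> + c / sqrt (real T)"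
proof -
  obtain N where N: "\<And>\<gamma>. \<gamma> \<in> borel_probs (Y \<times> U) \<Longrightarrow> (\<And>\<gamma>'. \<gamma>' \<in> W \<Longrightarrow> \<epsilon> \<le> rho q \<gamma> \<gamma>') \<Longrightarrow>
      1 \<le> real (Suc N) * (\<Sum>k<N. \<bar>\<integral>x. drift f \<mu> (test k) x \<partial>\<gamma>\<bar>)"
    using near_W[OF assms] by auto
  show thesis
  proof (rule that)
    fix \<pi> y0 and T :: nat
    assume \<pi>: "\<pi> \<in> control_plans U S" and y0: "y0 \<in> Y" and T: "T \<ge> 1"
    let ?\<chi> = "random_occ_measure Y U f \<sigma> \<pi> y0 T"
    let ?h = "\<lambda>\<omega>. \<Sum>k<N. \<bar>\<integral>x. drift f \<mu> (test k) x \<partial>?\<chi> \<omega>\<bar>"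
    note h = expectation_sum_drift_le[OF \<pi> y0 T, of N]
    have "expectation (\<lambda>\<omega>. rho_set q (?\<chi> \<omega>) W) \<le> expectation (\<lambda>\<omega>. \<epsilon> + 2 * real (Suc N) * ?h \<omega>)"
    \<comment> \<open>The rule asks for an integrable nonnegative majorant. Nonnegativity takes care
      of a left side that fails to be integrable and so has integral 0.\<close>
    proof (rule integral_mono')
      show "integrable M (\<lambda>\<omega>. \<epsilon> + 2 * real (Suc N) * ?h \<omega>)"
        using h(1) by (intro Bochner_Integration.integrable_add integrable_mult_right) auto
      fix \<omega> assume "\<omega> \<in> space M"
      note \<chi> = random_occ_measure_in_borel_probs[OF \<pi> y0 T this]
      have h0: "?h \<omega> \<ge> 0" by (intro sum_nonneg) simp
      then have h1: "2 * real (Suc N) * ?h \<omega> \<ge> 0" by (intro mult_nonneg_nonneg) auto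
      then show "0 \<le> \<epsilon> + 2 * real (Suc N) * ?h \<omega>" using assms by linarith
      show "rho_set q (?\<chi> \<omega>) W \<le> \<epsilon> + 2 * real (Suc N) * ?h \<omega>"
      proof (cases "\<exists>\<gamma>'\<in>W. rho q (?\<chi> \<omega>) \<gamma>' < \<epsilon>")
        case True
        then obtain \<gamma>' where "\<gamma>' \<in> W" "rho q (?\<chi> \<omega>) \<gamma>' < \<epsilon>" by blast
        with rho_set_le_rho[OF q \<chi> W_subset, of \<gamma>'] h1 show ?thesis by linarith
      next
        case False
        then have "1 \<le> real (Suc N) * ?h \<omega>" by (intro N[OF \<chi>]) (auto simp: not_less)
        with rho_set_le_2[OF y0 \<chi>] assms show ?thesis unfolding mult.assoc by linarith
      qed
    qed
    also have "\<dots> = \<epsilon> + 2 * real (Suc N) * expectation ?h"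
      using h(1) by (simp add: prob_space)
    also have "\<dots> \<le> \<epsilon> + 2 * real (Suc N) * (real N * (4 / sqrt (real T)))"
      by (intro add_left_mono mult_left_mono h(2)) simp
    finally show "expectation (\<lambda>\<omega>. rho_set q (?\<chi> \<omega>) W) \<le> \<epsilon> + (2 * real (Suc N) * (real N * 4)) / sqrt (real T)"
      by simp
  qed
qed

text \<open>In the bound \<open>\<epsilon> + c / sqrt T\<close> the constant depends on
  \<open>\<epsilon>\<close>, so no explicit rate results. The supremum over plans and initial states
  is taken as \<open>\<nu> T\<close> and shown to vanish in the limit.\<close>

lemma expectation_rho_set_uniform_limit:
  shows "\<exists>\<nu> :: nat \<Rightarrow> real. \<nu> \<longlonglongrightarrow> 0 \<and> (\<forall>y0\<in>Y. \<forall>T\<ge>1. \<forall>\<pi>\<in>control_plans U S.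
    expectation (\<lambda>\<omega>. rho_set q (random_occ_measure Y U f \<sigma> \<pi> y0 T \<omega>) W) \<le> \<nu> T)"
proof -
  let ?e = "\<lambda>T (\<pi>, y0). expectation (\<lambda>\<omega>. rho_set q (random_occ_measure Y U f \<sigma> \<pi> y0 T \<omega>) W)"
  \<comment> \<open>The element 0 keeps the set nonempty and gives \<open>\<nu> T \<ge> 0\<close>
    for \<open>T \<ge> 1\<close>, which settles the lower half of the convergence.\<close>
  define E where "E T = insert 0 (?e T ` (control_plans U S \<times> Y))" for T
  define \<nu> where "\<nu> T = Sup (E T)" for T
  have bdd: "bdd_above (E T)" if T: "T \<ge> 1" for T
  proof (rule bdd_aboveI[of _ 2])
    fix e assume "e \<in> E T"
    then consider "e = 0" | \<pi> y0 where "\<pi> \<in> control_plans U S" "y0 \<in> Y" "e = ?e T (\<pi>, y0)"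
      by (auto simp: E_def)
    then show "e \<le> 2"
    proof cases
      case 2
      have "e \<le> expectation (\<lambda>_. 2)"
        unfolding 2(3) prod.case
        using rho_set_le_2[OF 2(2) random_occ_measure_in_borel_probs[OF 2(1,2) T]]
        by (intro integral_mono') auto
      then show ?thesis by (simp add: prob_space)
    qed simp
  qed
  have "\<nu> \<longlonglongrightarrow> 0"
  proof (rule order_tendstoI)
    fix a :: real assume "a < 0"
    show "\<forall>\<^sub>F T in sequentially. a < \<nu> T"
      using eventually_ge_at_top[of 1]
    proof eventually_elim
      case (elim T)
      have "0 \<le> \<nu> T" unfolding \<nu>_def by (rule cSup_upper[OF _ bdd[OF elim]]) (simp add: E_def)
      with \<open>a < 0\<close> show ?case by simp
    qed
  next
    fix a :: real assume "0 < a"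
    then have "a / 2 > 0" by simp
    from expectation_rho_set_le[OF this] obtain c where
      c: "\<And>\<pi> y0 T. \<pi> \<in> control_plans U S \<Longrightarrow> y0 \<in> Y \<Longrightarrow> T \<ge> 1 \<Longrightarrow> ?e T (\<pi>, y0) \<le> a / 2 + c / sqrt (real T)"
      by auto
    \<comment> \<open>The sign of \<open>c\<close> is not known; with its absolute value the bound
      is nonnegative and so covers the element 0 too.\<close>
    have "(\<lambda>T. a / 2 + \<bar>c\<bar> / sqrt (real T)) \<longlonglongrightarrow> a / 2 + 0"
      by (intro tendsto_add tendsto_const real_tendsto_divide_at_top[OF tendsto_const]
          filterlim_compose[OF sqrt_at_top filterlim_real_sequentially])
    then have "\<forall>\<^sub>F T in sequentially. a / 2 + \<bar>c\<bar> / sqrt (real T) < a"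
      by (rule order_tendstoD(2)) (use \<open>0 < a\<close> in simp)
    then show "\<forall>\<^sub>F T in sequentially. \<nu> T < a"
      using eventually_ge_at_top[of 1]
    proof eventually_elim
      case (elim T)
      have "\<nu> T \<le> a / 2 + \<bar>c\<bar> / sqrt (real T)"
        unfolding \<nu>_def
      proof (rule cSup_least)
        fix e assume "e \<in> E T"
        then consider "e = 0" | \<pi> y0 where "\<pi> \<in> control_plans U S" "y0 \<in> Y" "e = ?e T (\<pi>, y0)"
          by (auto simp: E_def)
        then show "e \<le> a / 2 + \<bar>c\<bar> / sqrt (real T)"
        proof cases
          case 2
          have "c / sqrt (real T) \<le> \<bar>c\<bar> / sqrt (real T)" by (intro divide_right_mono) auto
          with c[OF 2(1,2) elim(2)] 2(3) show ?thesis by linarith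
        qed (use \<open>0 < a\<close> in simp)
      qed (simp add: E_def)
      with elim(1) show ?case by linarith
    qed
  qed
  moreover have "?e T (\<pi>, y0) \<le> \<nu> T" if "y0 \<in> Y" "T \<ge> 1" "\<pi> \<in> control_plans U S" for y0 T \<pi>
    unfolding \<nu>_def by (rule cSup_upper[OF _ bdd[OF that(2)]]) (use that in \<open>auto simp: E_def\<close>)
  ultimately show ?thesis by auto
qed

end

end

theorem theorem4p4:
  fixes Y :: "(real ^ 'm::finite) set"
    and U :: "'u::metric_space set"
    and S :: "'s::metric_space set"
    and f :: "(real ^ 'm) \<times> 'u \<times> 's \<Rightarrow> real ^ 'm"
    and M :: "'w measure"
    and \<sigma> :: "nat \<Rightarrow> 'w \<Rightarrow> 's"
    and q :: "nat \<Rightarrow> (real ^ 'm) \<times> 'u \<Rightarrow> real"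
  assumes "compact Y" and "compact U" and "compact S"
    and "continuous_on (Y \<times> U \<times> S) f"
    and "\<And>y u s. y \<in> Y \<Longrightarrow> u \<in> U \<Longrightarrow> s \<in> S \<Longrightarrow> f (y, u, s) \<in> Y"
    and "prob_space M"
    and "prob_space.indep_vars M (\<lambda>_. restrict_space borel S) \<sigma> UNIV"
    and "\<And>t. distr M (restrict_space borel S) (\<sigma> t) = distr M (restrict_space borel S) (\<sigma> 0)"
    and "dense_lipschitz_seq (Y \<times> U) q"
  shows "\<exists>\<nu> :: nat \<Rightarrow> real. \<nu> \<longlonglongrightarrow> 0 \<and>
    (\<forall>y0\<in>Y. \<forall>T\<ge>1.
      (SUP \<xi>\<in>random_occ_measures Y U S f \<sigma> T y0.
         ereal (prob_space.expectation M (\<lambda>\<omega>.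
           rho_set q (\<xi> \<omega>)
             (stationary_measures Y U f (distr M (restrict_space borel S) (\<sigma> 0))))))
      \<le> ereal (\<nu> T))"
proof -
  interpret controlled_system M Y U S f \<sigma>
    by (intro controlled_system.intro controlled_system_axioms.intro)
       (use assms in \<open>auto simp: image_subset_iff\<close>)
  show ?thesis
  \<comment> \<open>Without initial states there is nothing to show; without plans the supremum over
    the empty set is minus infinity in the extended reals.\<close>
  proof (cases "Y = {} \<or> control_plans U S = {}")
    case True
    then show ?thesis
      by (intro exI[of _ "\<lambda>_. 0"]) (auto simp: random_occ_measures_def bot_ereal_def)
  next
    case False
    then obtain y0 \<pi> where y0: "y0 \<in> Y" and \<pi>: "\<pi> \<in> control_plans U S" by blast
    obtain \<omega> where "\<omega> \<in> space M" using not_empty by blast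
    \<comment> \<open>A point of \<open>U\<close> is required to freeze the tests; the first control
      of any plan along any noise path supplies one.\<close>
    then have "control \<pi> (\<lambda>i. \<sigma> i \<omega>) 0 \<in> U"
      using state_control_in(2)[OF \<pi> y0] \<sigma>_in_S by simp
    from expectation_rho_set_uniform_limit[OF assms(9) this] obtain \<nu> where
      \<nu>: "\<nu> \<longlonglongrightarrow> 0" "\<forall>y0\<in>Y. \<forall>T\<ge>1. \<forall>\<pi>\<in>control_plans U S.
        expectation (\<lambda>\<omega>. rho_set q (random_occ_measure Y U f \<sigma> \<pi> y0 T \<omega>) (stationary_measures Y U f \<mu>)) \<le> \<nu> T"
      by blast
    show ?thesis
    proof (intro exI[of _ \<nu>] conjI \<nu>(1) ballI allI impI)
      fix y0 T assume "y0 \<in> Y" "(1::nat) \<le> T"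
      with \<nu>(2) show "(SUP \<xi>\<in>random_occ_measures Y U S f \<sigma> T y0. ereal (expectation (\<lambda>\<omega>.
          rho_set q (\<xi> \<omega>) (stationary_measures Y U f (distr M (restrict_space borel S) (\<sigma> 0))))))
        \<le> ereal (\<nu> T)"
        unfolding \<mu>_def[symmetric] by (intro SUP_least) (auto simp: random_occ_measures_def)
    qed
  qed
qed

end
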